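(* Assume $\inf_{x\in\mathbb R}V''(x)>0$. Then for every integer $n\ge1$, $$\inf_{x\in\mathbb R}V''(x)\ \le\ \lambda_n(-L)-\lambda_{n-1}(-L)\ \le\ \sup_{x\in\mathbb R}V''(x),$$ with the right-hand side equal to $+\infty$ if $V''$ is unbounded from above.
   Context: $V\in C^\infty(\mathbb R)$, $\mu$ the probability measure with density proportional to $e^{-V}$, $Lf=f''-V'f'$, self-adjoint in $L^2(\mu)$ (unique extension from $C_0^\infty(\mathbb R)$). $\lambda_0(-L)=0$ and for $n\ge1$, $\lambda_n(-L)=\sup_{g_0,\dots,g_{n-1}\in L^2(\mu)}\inf_{f\in D(-L)\setminus\{0\},\,f\perp_\mu g_i}\frac{\int f(-Lf)\,d\mu}{\int f^2d\mu}$. *)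

theory Defs
  imports "HOL-Analysis.Analysis"
begin

definition smooth :: "(real \<Rightarrow> real) \<Rightarrow> bool" where
  "smooth f \<longleftrightarrow> (\<forall>k x. ((deriv ^^ k) f) differentiable (at x))"

definition test_fun :: "(real \<Rightarrow> real) \<Rightarrow> bool" where
  "test_fun \<phi> \<longleftrightarrow> smooth \<phi> \<and> (\<exists>R. \<forall>x. R < \<bar>x\<bar> \<longrightarrow> \<phi> x = 0)"

definition Lop :: "(real \<Rightarrow> real) \<Rightarrow> (real \<Rightarrow> real) \<Rightarrow> real \<Rightarrow> real" where
  "Lop V f = (\<lambda>x. deriv (deriv f) x - deriv V x * deriv f x)"

definition normconst :: "(real \<Rightarrow> real) \<Rightarrow> real" where
  "normconst V = (\<integral>x. exp (- V x) \<partial>lborel)"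

definition mu :: "(real \<Rightarrow> real) \<Rightarrow> real measure" where
  "mu V = density lborel (\<lambda>x. ennreal (exp (- V x) / normconst V))"

definition L2 :: "(real \<Rightarrow> real) \<Rightarrow> (real \<Rightarrow> real) \<Rightarrow> bool" where
  "L2 V f \<longleftrightarrow> f \<in> borel_measurable borel \<and> integrable (mu V) (\<lambda>x. (f x)^2)"

text \<open>Graph of the self-adjoint extension of L, i.e. the closure in L2(mu) x L2(mu)
  of the graph of L restricted to C_0^infinity: pairs (f, Lf).\<close>
definition L_graph :: "(real \<Rightarrow> real) \<Rightarrow> ((real \<Rightarrow> real) \<times> (real \<Rightarrow> real)) set" where
  "L_graph V = {(f, h). L2 V f \<and> L2 V h \<and>
     (\<exists>\<phi> :: nat \<Rightarrow> real \<Rightarrow> real. (\<forall>k. test_fun (\<phi> k)) \<and>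
        (\<lambda>k. \<integral>x. (\<phi> k x - f x)^2 \<partial>mu V) \<longlonglongrightarrow> 0 \<and>
        (\<lambda>k. \<integral>x. (Lop V (\<phi> k) x - h x)^2 \<partial>mu V) \<longlonglongrightarrow> 0)}"

definition eigval :: "(real \<Rightarrow> real) \<Rightarrow> nat \<Rightarrow> ereal" where
  "eigval V n = (if n = 0 then 0 else
     (SUP g \<in> {g :: nat \<Rightarrow> real \<Rightarrow> real. \<forall>i<n. L2 V (g i)}.
        INF fh \<in> {(f, h). (f, h) \<in> L_graph V \<and> (\<integral>x. (f x)^2 \<partial>mu V) \<noteq> 0 \<and>
                           (\<forall>i<n. (\<integral>x. f x * g i x \<partial>mu V) = 0)}.
          ereal ((- (\<integral>x. fst fh x * snd fh x \<partial>mu V)) / (\<integral>x. (fst fh x)^2 \<partial>mu V))))"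

end

theory Submission
  imports Defs "HOL-Probability.Distributions" "HOL-Real_Asymp.Real_Asymp"
begin

text \<open>
  Write \<open>d\<close> for the derivative and \<open>d* w = V' w - w'\<close> for its adjoint in \<open>L\<^sup>2(\<mu>)\<close>, so that
  \<open>-L = d* d\<close> and \<open>d d* = -L + V''\<close>. Since \<open>ker d\<close> consists of the constants and \<open>d*\<close> is
  injective, the \<open>n\<close>-th eigenvalue of \<open>d* d\<close> is the \<open>(n-1)\<close>-st eigenvalue of \<open>d d*\<close>, and
  \<open>inf V'' \<le> V'' \<le> sup V''\<close> gives the claim. The identification of the two spectra is done on the
  level of the max-min formula: orthogonality constraints are transported by the bounded inverses
  of \<open>d\<close> and \<open>d*\<close>, and \<open>|d* w|\<^sup>2 \<ge> c |w|\<^sup>2\<close> passes to \<open>|d f|\<^sup>2 \<ge> c |f|\<^sup>2\<close> (and back) through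
  \<open>|f|\<^sup>2 = \<langle>d* w, f\<rangle> = \<langle>w, d f\<rangle> \<le> |w| |d f|\<close> for \<open>f = d* w\<close>. Since constraints can be
  met exactly by small corrections, only test functions are needed, and no compactness or spectral theorem.
\<close>

section \<open>Smooth functions and test functions\<close>

text \<open>The two bounds are not symmetric. For the lower bound one starts from a mean-zero test
  function, whose preimage under \<open>d*\<close> is again a test function. For the upper bound one
  starts from a test function \<open>w\<close> and needs some \<open>f\<close> with derivative
  \<open>w\<close>. Such an \<open>f\<close> is merely constant near each end, so cutoffs must place
  it in the graph closure. The cutoff error contains \<open>V'\<close>, which is square-integrable
  once \<open>V''\<close> is bounded; if \<open>V''\<close> is unbounded above, the upper bound is
  \<infinity> and nothing has to be shown.

  The index shifts by one because of the constants. In one direction the function 1 joins the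
  constraints; in the other, a constraint not orthogonal to 1 is spent on fixing the additive
  constant of \<open>f\<close>.

  The constraints are arbitrary L2 functions, so both inverses must map all of L2(mu) into itself.
  This is why the minimum point of \<open>V\<close> is the base point of integration: on the way
  from it to \<open>x\<close> the density decreases, and strong convexity makes the decrease
  Gaussian. Young's inequality for convolutions then applies.\<close>

fun times_diff :: "nat \<Rightarrow> (real \<Rightarrow> real) \<Rightarrow> bool" where
  "times_diff 0 f \<longleftrightarrow> True"
| "times_diff (Suc n) f \<longleftrightarrow> (\<forall>x. f differentiable (at x)) \<and> times_diff n (deriv f)"

text \<open>The recursion takes the first derivative off the inside of \<open>deriv ^^ k\<close>, so
  in the closure lemmas below the induction hypothesis, general in the functions, applies to the
  derivatives themselves.\<close>

lemma times_diff_iff: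
  "times_diff n f \<longleftrightarrow> (\<forall>k<n. \<forall>x. ((deriv ^^ k) f) differentiable (at x))"
proof (induction n arbitrary: f)
  case (Suc n)
  show ?case
    unfolding times_diff.simps Suc
    by (auto simp: less_Suc_eq_0_disj funpow_Suc_right simp del: funpow.simps)
qed simp

lemma smooth_iff_times_diff: "smooth f \<longleftrightarrow> (\<forall>n. times_diff n f)"
  unfolding smooth_def times_diff_iff by blast

lemma times_diff_SucI:
  assumes "\<And>x. (f has_real_derivative f' x) (at x)" and "times_diff n f'"
  shows "times_diff (Suc n) f"
proof -
  have "deriv f = f'"
    using assms(1) DERIV_imp_deriv by blast
  then show ?thesis
    using assms real_differentiable_def by auto
qed

lemma times_diff_Suc_DERIV:
  "times_diff (Suc n) f \<Longrightarrow> (f has_real_derivative deriv f x) (at x)"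
  by (simp add: DERIV_deriv_iff_real_differentiable)

lemma times_diff_SucD: "times_diff (Suc n) f \<Longrightarrow> times_diff n f"
  by (simp add: times_diff_iff)

lemma times_diff_const: "times_diff n (\<lambda>_. c)"
  by (induction n arbitrary: c) (auto simp: deriv_const[abs_def])

lemma times_diff_add:
  "times_diff n f \<Longrightarrow> times_diff n g \<Longrightarrow> times_diff n (\<lambda>x. f x + g x)"
proof (induction n arbitrary: f g)
  case (Suc n)
  show ?case
    by (rule times_diff_SucI[where f' = "\<lambda>x. deriv f x + deriv g x"])
       (use Suc in \<open>auto intro!: derivative_eq_intros times_diff_Suc_DERIV\<close>)
qed simp

lemma times_diff_mult:
  "times_diff n f \<Longrightarrow> times_diff n g \<Longrightarrow> times_diff n (\<lambda>x. f x * g x)"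
proof (induction n arbitrary: f g)
  case (Suc n)
  have "times_diff n (\<lambda>x. deriv f x * g x + f x * deriv g x)"
    using Suc by (intro times_diff_add Suc.IH) (auto dest: times_diff_SucD simp del: times_diff.simps(2), auto)
  moreover have "((\<lambda>x. f x * g x) has_real_derivative deriv f x * g x + f x * deriv g x) (at x)" for x
    using Suc.prems[THEN times_diff_Suc_DERIV, of x]
    by (auto intro!: derivative_eq_intros)
  ultimately show ?case
    by (intro times_diff_SucI)
qed simp

lemma times_diff_exp: "times_diff n f \<Longrightarrow> times_diff n (\<lambda>x. exp (f x))"
proof (induction n)
  case (Suc n)
  have "times_diff n (\<lambda>x. exp (f x) * deriv f x)"
    using Suc by (intro times_diff_mult Suc.IH) (auto dest: times_diff_SucD simp del: times_diff.simps(2), auto)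
  moreover have "((\<lambda>x. exp (f x)) has_real_derivative exp (f x) * deriv f x) (at x)" for x
    using Suc.prems[THEN times_diff_Suc_DERIV, of x]
    by (auto intro!: derivative_eq_intros)
  ultimately show ?case
    by (intro times_diff_SucI)
qed simp

lemma times_diff_affine: "times_diff n f \<Longrightarrow> times_diff n (\<lambda>x. f (a + b * x))"
proof (induction n arbitrary: f)
  case (Suc n)
  have "times_diff n (\<lambda>x. b * deriv f (a + b * x))"
    using Suc by (intro times_diff_mult times_diff_const Suc.IH) auto
  moreover have "((\<lambda>x. f (a + b * x)) has_real_derivative b * deriv f (a + b * x)) (at x)" for x
  proof -
    have "((\<lambda>x. a + b * x) has_real_derivative b) (at x)"
      by (auto intro!: derivative_eq_intros)
    from DERIV_chain2[OF times_diff_Suc_DERIV[OF Suc.prems] this] show ?thesis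
      by (simp add: mult.commute)
  qed
  ultimately show ?case
    by (intro times_diff_SucI)
qed simp

lemma smooth_const: "smooth (\<lambda>_. c)"
  by (simp add: smooth_iff_times_diff times_diff_const)

lemma smooth_add: "smooth f \<Longrightarrow> smooth g \<Longrightarrow> smooth (\<lambda>x. f x + g x)"
  by (simp add: smooth_iff_times_diff times_diff_add)

lemma smooth_mult: "smooth f \<Longrightarrow> smooth g \<Longrightarrow> smooth (\<lambda>x. f x * g x)"
  by (simp add: smooth_iff_times_diff times_diff_mult)

lemma smooth_diff: "smooth f \<Longrightarrow> smooth g \<Longrightarrow> smooth (\<lambda>x. f x - g x)"
  using smooth_add[of f "\<lambda>x. (-1) * g x"] smooth_mult[OF smooth_const, of g "-1"] by simp

lemma smooth_exp: "smooth f \<Longrightarrow> smooth (\<lambda>x. exp (f x))"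
  by (simp add: smooth_iff_times_diff times_diff_exp)

lemma smooth_affine: "smooth f \<Longrightarrow> smooth (\<lambda>x. f (a + b * x))"
  by (simp add: smooth_iff_times_diff times_diff_affine)

lemma smooth_deriv: "smooth f \<Longrightarrow> smooth (deriv f)"
  unfolding smooth_iff_times_diff using times_diff.simps(2) by blast

lemma smooth_antideriv:
  assumes "\<And>x. (F has_real_derivative f x) (at x)" and "smooth f"
  shows "smooth F"
  unfolding smooth_iff_times_diff
proof
  fix n show "times_diff n F"
    using assms by (cases n) (auto simp: smooth_iff_times_diff intro!: times_diff_SucI simp del: times_diff.simps(2))
qed

lemma smooth_DERIV: "smooth f \<Longrightarrow> (f has_real_derivative deriv f x) (at x)"
  unfolding smooth_iff_times_diff using times_diff_Suc_DERIV by blast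

lemma smooth_continuous: "smooth f \<Longrightarrow> continuous_on S f"
  by (meson DERIV_isCont continuous_at_imp_continuous_on smooth_DERIV)

lemma smooth_measurable: "smooth f \<Longrightarrow> f \<in> borel_measurable borel"
  by (simp add: borel_measurable_continuous_onI smooth_continuous)

lemmas smooth_intros = smooth_const smooth_add smooth_mult smooth_diff smooth_exp smooth_affine smooth_deriv

lemma smooth_antideriv_exists:
  assumes "smooth f"
  obtains F where "\<And>x. (F has_real_derivative f x) (at x)" "smooth F"
proof -
  obtain F where "\<And>x. (F has_vector_derivative f x) (at x)"
    using einterval_antiderivative[of "-\<infinity>" "\<infinity>" f] smooth_continuous[OF assms, of UNIV]
    by (auto simp: continuous_on_eq_continuous_at)
  then have "\<And>x. (F has_real_derivative f x) (at x)"
    by (simp add: has_real_derivative_iff_has_vector_derivative)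
  with that smooth_antideriv assms show thesis by blast
qed

lemma deriv_eq_0_on_open:
  fixes f :: "real \<Rightarrow> real"
  assumes "open S" "\<And>y. y \<in> S \<Longrightarrow> f y = c" "x \<in> S"
  shows "deriv f x = 0"
proof -
  have "\<forall>\<^sub>F y in nhds x. f y = c"
    using assms by (auto simp: eventually_nhds)
  then have "deriv f x = deriv (\<lambda>_. c) x"
    by (rule deriv_cong_ev) simp
  then show ?thesis by simp
qed

lemma open_abs_greater: "open {x::real. R < \<bar>x\<bar>}" and open_abs_less: "open {x::real. \<bar>x\<bar> < R}"
  by (intro open_Collect_less continuous_intros)+

lemma test_funI: "smooth f \<Longrightarrow> (\<And>x. R < \<bar>x\<bar> \<Longrightarrow> f x = 0) \<Longrightarrow> test_fun f"
  unfolding test_fun_def by blast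

lemma test_fun_smooth: "test_fun f \<Longrightarrow> smooth f"
  unfolding test_fun_def by blast

lemma test_fun_supportE:
  assumes "test_fun f"
  obtains R where "R > 0" "\<And>x. R < \<bar>x\<bar> \<Longrightarrow> f x = 0"
proof -
  obtain R where R: "\<forall>x. R < \<bar>x\<bar> \<longrightarrow> f x = 0"
    using assms unfolding test_fun_def by blast
  show thesis
    by (rule that[of "max R 1"]) (use R in auto)
qed

lemma test_fun_add:
  assumes "test_fun f" "test_fun g"
  shows "test_fun (\<lambda>x. f x + g x)"
proof -
  obtain R R' where "\<And>x. R < \<bar>x\<bar> \<Longrightarrow> f x = 0" "\<And>x. R' < \<bar>x\<bar> \<Longrightarrow> g x = 0"
    using assms test_fun_supportE by metis
  then show ?thesis
    using assms by (intro test_funI[where R = "max R R'"]) (auto intro: smooth_add test_fun_smooth)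
qed

lemma test_fun_mult:
  assumes "smooth f" "test_fun g"
  shows "test_fun (\<lambda>x. f x * g x)"
proof -
  obtain R where "\<And>x. R < \<bar>x\<bar> \<Longrightarrow> g x = 0"
    using assms test_fun_supportE by metis
  then show ?thesis
    using assms by (intro test_funI[where R = R]) (auto intro: smooth_mult test_fun_smooth)
qed

lemma test_fun_cmult: "test_fun g \<Longrightarrow> test_fun (\<lambda>x. c * g x)"
  by (rule test_fun_mult[OF smooth_const])

lemma test_fun_diff: "test_fun f \<Longrightarrow> test_fun g \<Longrightarrow> test_fun (\<lambda>x. f x - g x)"
  using test_fun_add[of f "\<lambda>x. (-1) * g x"] test_fun_cmult[of g "-1"] by simp

lemma test_fun_deriv:
  assumes "test_fun f"
  shows "test_fun (deriv f)"
proof -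
  obtain R where "\<And>x. R < \<bar>x\<bar> \<Longrightarrow> f x = 0"
    using assms test_fun_supportE by metis
  then have "deriv f x = 0" if "R < \<bar>x\<bar>" for x
    using deriv_eq_0_on_open[OF open_abs_greater, of R f 0 x] that by blast
  then show ?thesis
    using assms by (intro test_funI[where R = R]) (auto intro: smooth_deriv test_fun_smooth)
qed

lemma test_fun_bounded:
  assumes "test_fun f"
  obtains B where "\<And>x. \<bar>f x\<bar> \<le> B"
proof -
  obtain R where R: "\<And>x. R < \<bar>x\<bar> \<Longrightarrow> f x = 0"
    using assms test_fun_supportE by metis
  have "continuous_on {-R..R} f"
    by (simp add: assms smooth_continuous test_fun_smooth)
  then obtain B where B: "\<And>x. x \<in> {-R..R} \<Longrightarrow> \<bar>f x\<bar> \<le> B"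
    using continuous_on_compact_bound[OF compact_Icc] by (metis real_norm_def)
  have "\<bar>f x\<bar> \<le> max B 0" for x
  proof (cases "R < \<bar>x\<bar>")
    case False
    then have "x \<in> {-R..R}" by auto
    then show ?thesis using B[of x] by linarith
  qed (use R in simp)
  then show thesis by (rule that)
qed

text \<open>Beyond the support of its derivative, \<open>f\<close> is constant on each half-line,
  possibly with two different values. Primitives of test functions are of this kind.\<close>

lemma bounded_of_test_fun_deriv:
  assumes f: "smooth f" and f': "test_fun (deriv f)"
  obtains B where "\<And>x. \<bar>f x\<bar> \<le> B"
proof -
  obtain R where R: "R > 0" "\<And>x. R < \<bar>x\<bar> \<Longrightarrow> deriv f x = 0"
    using test_fun_supportE[OF f'] by metis
  have const: "f x = f y" if xy: "x < y" "y \<le> - R \<or> R \<le> x" for x y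
  proof -
    obtain z where "x < z" "z < y" "f y - f x = (y - x) * deriv f z"
      using MVT2[of x y f "deriv f"] smooth_DERIV[OF f] xy(1) by blast
    with R(2)[of z] xy(2) show ?thesis by auto
  qed
  obtain B where B: "\<And>x. x \<in> {-R..R} \<Longrightarrow> \<bar>f x\<bar> \<le> B"
    using continuous_on_compact_bound[OF compact_Icc smooth_continuous[OF f]] by (metis real_norm_def)
  have "\<bar>f x\<bar> \<le> B" for x
  proof -
    consider "x < - R" | "x \<in> {-R..R}" | "R < x" by force
    then show ?thesis
      by cases (use B[of x] B[of R] B[of "-R"] const[of x "-R"] const[of R x] R(1) in auto)
  qed
  then show thesis by (rule that)
qed

section \<open>Cutoff functions\<close>

text \<open>The family of the functions \<open>p(1/x) exp(-1/x)\<close> is closed under differentiation.\<close>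

definition flat_fun :: "real poly \<Rightarrow> real \<Rightarrow> real" where
  "flat_fun p x = (if x > 0 then poly p (1/x) * exp (-1/x) else 0)"

lemma poly_exp_tendsto_0: "((\<lambda>y. poly p y * exp (-y)) \<longlongrightarrow> 0) (at_top :: real filter)"
proof (induction p)
  case (pCons a p)
  have "((\<lambda>y. poly q y * y * exp (-y)) \<longlongrightarrow> 0) (at_top :: real filter)" for q :: "real poly"
  proof -
    have "((\<lambda>y. \<Sum>i\<le>degree q. coeff q i * (y ^ Suc i * exp (-y))) \<longlongrightarrow> (\<Sum>i\<le>degree q. coeff q i * 0)) at_top"
      using tendsto_power_div_exp_0
      by (intro tendsto_intros) (simp add: exp_minus divide_inverse del: power_Suc)
    then show ?thesis
      by (simp add: poly_altdef sum_distrib_left sum_distrib_right mult_ac)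
  qed
  from this[of p] have "((\<lambda>y. a * exp (-y) + poly p y * y * exp (-y)) \<longlongrightarrow> a * 0 + 0) at_top"
    by (intro tendsto_intros) real_asymp
  then show ?case
    by (simp add: algebra_simps)
qed simp

text \<open>With y = 1/x, d/dx is -y^2 d/dy, and p(y) exp(-y) has y-derivative (p' - p)(y) exp(-y);
  this gives the polynomial y^2 (p - p').\<close>

lemma flat_fun_DERIV:
  "(flat_fun p has_real_derivative flat_fun ([:0,0,1:] * (p - pderiv p)) x) (at x)"
proof (cases x "0::real" rule: linorder_cases)
  case greater
  have "((\<lambda>x. poly p (1/x) * exp (-1/x)) has_real_derivative
      flat_fun ([:0,0,1:] * (p - pderiv p)) x) (at x)"
    using greater
    by (auto intro!: derivative_eq_intros DERIV_chain2[OF poly_DERIV]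
        simp: flat_fun_def field_simps power2_eq_square)
  moreover have "\<forall>\<^sub>F y in nhds x. flat_fun p y = poly p (1/y) * exp (-1/y)"
    using eventually_nhds_in_open[of "{0<..}" x] greater by (auto simp: flat_fun_def elim!: eventually_mono)
  ultimately show ?thesis
    by (subst DERIV_cong_ev[OF refl _ refl])
next
  case less
  have "\<forall>\<^sub>F y in nhds x. flat_fun p y = 0"
    using eventually_nhds_in_open[of "{..<0}" x] less by (auto simp: flat_fun_def elim!: eventually_mono)
  then show ?thesis
    using less by (subst DERIV_cong_ev[OF refl _ refl]) (auto simp: flat_fun_def)
next
  case equal
  have "((\<lambda>h. flat_fun p h / h) \<longlongrightarrow> 0) (at_right 0)"
  proof -
    \<comment> \<open>The difference quotient at 0 is y p(y) exp(-y) with y = 1/h, and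
      \<open>pCons 0 p\<close> is the polynomial y p(y).\<close>
    have "((\<lambda>h::real. poly (pCons 0 p) (1/h) * exp (- (1/h))) \<longlongrightarrow> 0) (at_right 0)"
      by (rule filterlim_compose[OF poly_exp_tendsto_0]) real_asymp
    then show ?thesis
      by (rule Lim_transform_eventually)
         (auto simp: eventually_at_filter flat_fun_def field_simps)
  qed
  moreover have "((\<lambda>h. flat_fun p h / h) \<longlongrightarrow> 0) (at_left 0)"
    by (rule Lim_transform_eventually[OF tendsto_const])
       (auto simp: eventually_at_filter flat_fun_def)
  ultimately show ?thesis
    using equal filterlim_split_at_real by (auto simp: DERIV_def flat_fun_def)
qed

lemma smooth_flat_fun: "smooth (flat_fun p)"
proof -
  have "times_diff n (flat_fun p)" for n
    by (induction n arbitrary: p) (auto intro!: times_diff_SucI flat_fun_DERIV simp del: times_diff.simps(2))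
  then show ?thesis
    by (simp add: smooth_iff_times_diff)
qed

lemma smooth_step_exists:
  obtains S :: "real \<Rightarrow> real" where "smooth S" "\<And>x. x \<le> 0 \<Longrightarrow> S x = 0" "\<And>x. 1 \<le> x \<Longrightarrow> S x = 1"
proof -
  \<comment> \<open>A bump that is positive exactly on (0,1); its normalised primitive is the step.
    The argument has the form \<open>a + b * x\<close> to match
    \<open>smooth_affine\<close>.\<close>
  define b where "b x = flat_fun 1 x * flat_fun 1 (1 + (-1) * x)" for x
  have "smooth b"
    unfolding b_def by (intro smooth_intros smooth_flat_fun)
  then obtain F where F: "\<And>x. (F has_real_derivative b x) (at x)" "smooth F"
    using smooth_antideriv_exists by metis
  have b0: "b x = 0" if "x \<le> 0 \<or> 1 \<le> x" for x
    using that by (auto simp: b_def flat_fun_def)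
  have bpos: "b x > 0" if "0 < x" "x < 1" for x
    using that by (auto simp: b_def flat_fun_def)
  have const: "F x = F y" if xy: "x < y" "y \<le> 0 \<or> 1 \<le> x" for x y
  proof -
    obtain z where "x < z" "z < y" "F y - F x = (y - x) * b z"
      using MVT2[of x y F b] F(1) xy(1) by blast
    with b0[of z] xy show ?thesis by auto
  qed
  have lt: "F 0 < F 1"
  proof -
    obtain z where "0 < z" "z < 1" "F 1 - F 0 = (1 - 0) * b z"
      using MVT2[of 0 1 F b] F(1) by auto
    with bpos[of z] show ?thesis by auto
  qed
  define S where "S x = (F x - F 0) * (1 / (F 1 - F 0))" for x
  show thesis
  proof
    show "smooth S"
      unfolding S_def by (intro smooth_intros F)
    show "S x = 0" if "x \<le> 0" for x
      using const[of x 0] that by (cases "x = 0") (auto simp: S_def)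
    show "S x = 1" if "1 \<le> x" for x
      using const[of 1 x] that lt by (cases "x = 1") (auto simp: S_def)
  qed
qed

text \<open>The two flanks of each cutoff are translates of one fixed profile, so a single constant
  bounds the derivatives for all \<open>k\<close>.\<close>

lemma smooth_cutoffs_exist:
  obtains cut :: "nat \<Rightarrow> real \<Rightarrow> real" and C :: real
  where "\<And>k. test_fun (cut k)" "\<And>k x. \<bar>x\<bar> \<le> real k \<Longrightarrow> cut k x = 1"
    "\<And>k x. \<bar>cut k x\<bar> \<le> C" "\<And>k x. \<bar>deriv (cut k) x\<bar> \<le> C" "\<And>k x. \<bar>deriv (deriv (cut k)) x\<bar> \<le> C"
proof -
  obtain S :: "real \<Rightarrow> real" where S: "smooth S" "\<And>x. x \<le> 0 \<Longrightarrow> S x = 0" "\<And>x. 1 \<le> x \<Longrightarrow> S x = 1"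
    using smooth_step_exists by metis
  define S1 where "S1 = deriv S"
  define S2 where "S2 = deriv S1"
  have d: "(S has_real_derivative S1 x) (at x)" "(S1 has_real_derivative S2 x) (at x)" for x
    unfolding S2_def S1_def by (auto intro!: smooth_DERIV smooth_deriv S)
  have S1_0: "S1 x = 0" if "x < 0 \<or> 1 < x" for x
    unfolding S1_def
    using that S deriv_eq_0_on_open[of "{..<0}" S 0 x] deriv_eq_0_on_open[of "{1<..}" S 1 x] by auto
  have T1: "test_fun S1"
    by (rule test_funI[where R = 1]) (use S1_0 S(1) smooth_deriv in \<open>auto simp: S1_def abs_if split: if_splits\<close>)
  have T2: "test_fun S2"
    unfolding S2_def by (rule test_fun_deriv[OF T1])
  obtain B0 where B0: "\<And>x. x \<in> {0..1} \<Longrightarrow> \<bar>S x\<bar> \<le> B0"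
    using continuous_on_compact_bound[OF compact_Icc smooth_continuous[OF S(1)]] by (metis real_norm_def)
  have B0': "\<bar>S x\<bar> \<le> max B0 1" for x
    using B0[of x] S(2,3)[of x] by (cases "x \<le> 0"; cases "1 \<le> x") auto
  obtain B1 B2 where B12: "\<And>x. \<bar>S1 x\<bar> \<le> B1" "\<And>x. \<bar>S2 x\<bar> \<le> B2"
    using test_fun_bounded[OF T1] test_fun_bounded[OF T2] by metis
  define B where "B = max (max B0 1) (max B1 B2)"
  have B: "\<bar>S x\<bar> \<le> B" "\<bar>S1 x\<bar> \<le> B" "\<bar>S2 x\<bar> \<le> B" "B \<ge> 1" for x
    using B0'[of x] B12[of x] by (auto simp: B_def)
  have BB: "\<bar>u * v\<bar> \<le> B * B" if "\<bar>u\<bar> \<le> B" "\<bar>v\<bar> \<le> B" for u v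
    using that B(4) by (simp add: abs_mult mult_mono)
  define cut where "cut k x = S (1 + real k + 1 * x) * S (1 + real k + (-1) * x)" for k x
  have d1: "(cut k has_real_derivative
      S1 (1 + real k + x) * S (1 + real k - x) - S (1 + real k + x) * S1 (1 + real k - x)) (at x)" for k x
    unfolding cut_def
    by (auto intro!: derivative_eq_intros DERIV_chain2[OF d(1)])
  have D1: "deriv (cut k) = (\<lambda>x. S1 (1 + real k + x) * S (1 + real k - x) - S (1 + real k + x) * S1 (1 + real k - x))" for k
    using d1 DERIV_imp_deriv by blast
  have D2: "deriv (deriv (cut k)) x = S2 (1 + real k + x) * S (1 + real k - x)
     - S1 (1 + real k + x) * S1 (1 + real k - x) - S1 (1 + real k + x) * S1 (1 + real k - x)
     + S (1 + real k + x) * S2 (1 + real k - x)" for k x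
    unfolding D1
    by (rule DERIV_imp_deriv)
       (auto intro!: derivative_eq_intros DERIV_chain2[OF d(1)] DERIV_chain2[OF d(2)])
  have pos: "0 \<le> B * B" by simp
  show thesis
  proof
    show "test_fun (cut k)" for k
    proof (rule test_funI[where R = "1 + real k"])
      show "smooth (cut k)"
        unfolding cut_def by (intro smooth_intros S)
      show "cut k x = 0" if "1 + real k < \<bar>x\<bar>" for x
        using that S(2)[of "1 + real k + x"] S(2)[of "1 + real k - x"] by (auto simp: cut_def abs_if split: if_splits)
    qed
    show "cut k x = 1" if "\<bar>x\<bar> \<le> real k" for k x
      using that S(3)[of "1 + real k + x"] S(3)[of "1 + real k - x"] by (auto simp: cut_def abs_if split: if_splits)
    \<comment> \<open>The second derivative consists of four products, each at most
      \<open>B * B\<close>; the same constant covers the other two bounds.\<close>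
    show "\<bar>cut k x\<bar> \<le> 4 * (B * B)" for k x
      using BB[OF B(1) B(1), of "1 + real k + x" "1 + real k - x"] pos unfolding cut_def by simp
    show "\<bar>deriv (cut k) x\<bar> \<le> 4 * (B * B)" for k x
      using BB[OF B(2) B(1), of "1 + real k + x" "1 + real k - x"]
        BB[OF B(1) B(2), of "1 + real k + x" "1 + real k - x"] pos unfolding D1 by linarith
    show "\<bar>deriv (deriv (cut k)) x\<bar> \<le> 4 * (B * B)" for k x
      using BB[OF B(3) B(1), of "1 + real k + x" "1 + real k - x"]
        BB[OF B(1) B(3), of "1 + real k + x" "1 + real k - x"] 
        BB[OF B(2) B(2), of "1 + real k + x" "1 + real k - x"] pos unfolding D2 by linarith
  qed
qed

section \<open>Square-integrable functions\<close>

lemma square_integrable_mult: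
  fixes f g :: "'a \<Rightarrow> real"
  assumes [measurable]: "f \<in> borel_measurable M" "g \<in> borel_measurable M"
    and "integrable M (\<lambda>x. (f x)\<^sup>2)" "integrable M (\<lambda>x. (g x)\<^sup>2)"
  shows "integrable M (\<lambda>x. f x * g x)"
proof (rule Bochner_Integration.integrable_bound)
  show "integrable M (\<lambda>x. (f x)\<^sup>2 + (g x)\<^sup>2)"
    using assms by simp
  have "\<bar>a * b\<bar> \<le> a\<^sup>2 + b\<^sup>2" for a b :: real
  proof -
    have "0 \<le> (\<bar>a\<bar> - \<bar>b\<bar>)\<^sup>2" "0 \<le> \<bar>a * b\<bar>" by auto
    then show ?thesis
      unfolding power2_diff abs_mult power2_abs by linarith
  qed
  then show "AE x in M. norm (f x * g x) \<le> norm ((f x)\<^sup>2 + (g x)\<^sup>2)"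
    by (auto simp: order_trans[OF _ abs_ge_self])
qed measurable

lemma square_integrable_add:
  fixes f g :: "'a \<Rightarrow> real"
  assumes [measurable]: "f \<in> borel_measurable M" "g \<in> borel_measurable M"
    and "integrable M (\<lambda>x. (f x)\<^sup>2)" "integrable M (\<lambda>x. (g x)\<^sup>2)"
  shows "integrable M (\<lambda>x. (f x + g x)\<^sup>2)"
  using assms square_integrable_mult[OF assms]
  by (simp add: power2_sum mult.assoc)

lemma integral_Cauchy_Schwarz:
  fixes f g :: "'a \<Rightarrow> real"
  assumes [measurable]: "f \<in> borel_measurable M" "g \<in> borel_measurable M"
    and f2: "integrable M (\<lambda>x. (f x)\<^sup>2)" and g2: "integrable M (\<lambda>x. (g x)\<^sup>2)"
  shows "(\<integral>x. f x * g x \<partial>M)\<^sup>2 \<le> (\<integral>x. (f x)\<^sup>2 \<partial>M) * (\<integral>x. (g x)\<^sup>2 \<partial>M)"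
proof -
  define a b c where "a = (\<integral>x. (f x)\<^sup>2 \<partial>M)" "b = (\<integral>x. f x * g x \<partial>M)" "c = (\<integral>x. (g x)\<^sup>2 \<partial>M)"
  have fg: "integrable M (\<lambda>x. f x * g x)"
    using assms by (rule square_integrable_mult)
  have nonneg: "0 \<le> a + 2 * t * b + t\<^sup>2 * c" for t
  proof -
    have "0 \<le> (\<integral>x. (f x + t * g x)\<^sup>2 \<partial>M)"
      by simp
    also have "\<dots> = (\<integral>x. (f x)\<^sup>2 + 2 * t * (f x * g x) + t\<^sup>2 * (g x)\<^sup>2 \<partial>M)"
      by (simp add: power2_sum power_mult_distrib mult_ac add_ac)
    also have "\<dots> = a + 2 * t * b + t\<^sup>2 * c"
      using f2 g2 fg by (simp add: a_b_c_def)
    finally show ?thesis .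
  qed
  have "c \<ge> 0"
    by (simp add: a_b_c_def)
  have "b\<^sup>2 \<le> a * c"
  proof (cases "c = 0")
    case True
    have "b = 0"
    proof (rule ccontr)
      assume "b \<noteq> 0"
      \<comment> \<open>This \<open>t\<close> turns the now linear expression
        \<open>a + 2 * t * b\<close> into -1.\<close>
      with nonneg[of "- (a + 1) / (2 * b)"] True show False
        by (simp add: field_simps)
    qed
    with True show ?thesis by simp
  next
    case False
    with \<open>c \<ge> 0\<close> nonneg[of "- b / c"] show ?thesis
      by (simp add: field_simps power2_eq_square)
  qed
  then show ?thesis
    by (simp add: a_b_c_def)
qed

text \<open>Since d y^2 \<le> z (d x) \<le> z y, one may divide by y. With x, y, z the squared norms
  of u, Tu and T*Tu, it carries a lower bound for T to a lower bound for T* on the range of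
  T.\<close>

lemma mult_le_of_Cauchy_Schwarz:
  fixes d x y z :: real
  assumes "y\<^sup>2 \<le> z * x" "d * x \<le> y" "0 \<le> x" "0 \<le> y" "0 \<le> z"
  shows "d * y \<le> z"
proof (cases "y = 0 \<or> d \<le> 0")
  case True
  then show ?thesis
    using assms mult_nonpos_nonneg[of d y] by auto
next
  case False
  then have "y > 0" "d > 0" using assms by auto
  have "d * y * y \<le> d * (z * x)"
    using assms(1) \<open>d > 0\<close> by (simp add: power2_eq_square mult_left_mono mult.assoc)
  also have "\<dots> = z * (d * x)" by simp
  also have "\<dots> \<le> z * y"
    using assms by (intro mult_left_mono)
  finally show ?thesis
    using \<open>y > 0\<close> by simp
qed

section \<open>The space L2(mu): products, sums and limits of inner products\<close>

lemma measurable_mu_iff [simp]: "f \<in> borel_measurable (mu V) \<longleftrightarrow> f \<in> borel_measurable borel"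
  by (simp add: mu_def)

lemma L2_integrable_mult: "L2 V f \<Longrightarrow> L2 V g \<Longrightarrow> integrable (mu V) (\<lambda>x. f x * g x)"
  unfolding L2_def by (intro square_integrable_mult) auto

lemma L2_add: "L2 V f \<Longrightarrow> L2 V g \<Longrightarrow> L2 V (\<lambda>x. f x + g x)"
  unfolding L2_def by (auto intro!: square_integrable_add)

lemma L2_cmult: "L2 V f \<Longrightarrow> L2 V (\<lambda>x. c * f x)"
  unfolding L2_def by (auto simp: power_mult_distrib)

lemma L2_diff: "L2 V f \<Longrightarrow> L2 V g \<Longrightarrow> L2 V (\<lambda>x. f x - g x)"
  using L2_add[of V f "\<lambda>x. (-1) * g x"] L2_cmult[of V g "-1"] by simp

lemma L2_Cauchy_Schwarz:
  "L2 V f \<Longrightarrow> L2 V g \<Longrightarrow>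
    (\<integral>x. f x * g x \<partial>mu V)\<^sup>2 \<le> (\<integral>x. (f x)\<^sup>2 \<partial>mu V) * (\<integral>x. (g x)\<^sup>2 \<partial>mu V)"
  unfolding L2_def by (intro integral_Cauchy_Schwarz) auto

lemma L2_mult_tendsto_0:
  assumes u: "\<And>k. L2 V (u k)" and v: "\<And>k. L2 V (v k)"
    and u0: "(\<lambda>k. \<integral>x. (u k x)\<^sup>2 \<partial>mu V) \<longlonglongrightarrow> 0" and vl: "(\<lambda>k. \<integral>x. (v k x)\<^sup>2 \<partial>mu V) \<longlonglongrightarrow> l"
  shows "(\<lambda>k. \<integral>x. u k x * v k x \<partial>mu V) \<longlonglongrightarrow> 0"
proof -
  have "(\<lambda>k. (\<integral>x. (u k x)\<^sup>2 \<partial>mu V) * (\<integral>x. (v k x)\<^sup>2 \<partial>mu V)) \<longlonglongrightarrow> 0 * l"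
    by (intro tendsto_mult u0 vl)
  then have prod0: "(\<lambda>k. (\<integral>x. (u k x)\<^sup>2 \<partial>mu V) * (\<integral>x. (v k x)\<^sup>2 \<partial>mu V)) \<longlonglongrightarrow> 0"
    by simp
  have "(\<lambda>k. (\<integral>x. u k x * v k x \<partial>mu V)\<^sup>2) \<longlonglongrightarrow> 0"
    by (rule tendsto_sandwich[OF _ _ tendsto_const prod0])
       (auto simp: L2_Cauchy_Schwarz u v)
  then show ?thesis
    by simp
qed

lemma L2_mult_tendsto:
  assumes a: "\<And>k. L2 V (a k)" "L2 V a'" "(\<lambda>k. \<integral>x. (a k x - a' x)\<^sup>2 \<partial>mu V) \<longlonglongrightarrow> 0"
    and b: "\<And>k. L2 V (b k)" "L2 V b'" "(\<lambda>k. \<integral>x. (b k x - b' x)\<^sup>2 \<partial>mu V) \<longlonglongrightarrow> 0"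
  shows "(\<lambda>k. \<integral>x. a k x * b k x \<partial>mu V) \<longlonglongrightarrow> (\<integral>x. a' x * b' x \<partial>mu V)"
proof -
  have da: "L2 V (\<lambda>x. a k x - a' x)" and db: "L2 V (\<lambda>x. b k x - b' x)" for k
    by (intro L2_diff a b)+
  have "(\<lambda>k. (\<integral>x. (a k x - a' x) * (b k x - b' x) \<partial>mu V) + (\<integral>x. (a k x - a' x) * b' x \<partial>mu V)
      + (\<integral>x. (b k x - b' x) * a' x \<partial>mu V) + (\<integral>x. a' x * b' x \<partial>mu V))
    \<longlonglongrightarrow> 0 + 0 + 0 + (\<integral>x. a' x * b' x \<partial>mu V)"
    by (intro tendsto_add tendsto_const L2_mult_tendsto_0[OF da db a(3) b(3)]
        L2_mult_tendsto_0[OF da b(2) a(3) tendsto_const] L2_mult_tendsto_0[OF db a(2) b(3) tendsto_const])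
  also have "(\<lambda>k. (\<integral>x. (a k x - a' x) * (b k x - b' x) \<partial>mu V) + (\<integral>x. (a k x - a' x) * b' x \<partial>mu V)
      + (\<integral>x. (b k x - b' x) * a' x \<partial>mu V) + (\<integral>x. a' x * b' x \<partial>mu V))
    = (\<lambda>k. \<integral>x. a k x * b k x \<partial>mu V)"
  proof
    fix k
    have "(\<integral>x. a k x * b k x \<partial>mu V) =
      (\<integral>x. (a k x - a' x) * (b k x - b' x) + (a k x - a' x) * b' x + (b k x - b' x) * a' x + a' x * b' x \<partial>mu V)"
      by (simp add: algebra_simps)
    also have "\<dots> = (\<integral>x. (a k x - a' x) * (b k x - b' x) \<partial>mu V) + (\<integral>x. (a k x - a' x) * b' x \<partial>mu V)
      + (\<integral>x. (b k x - b' x) * a' x \<partial>mu V) + (\<integral>x. a' x * b' x \<partial>mu V)"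
      using L2_integrable_mult[OF da db] L2_integrable_mult[OF da b(2)] L2_integrable_mult[OF db a(2)]
        L2_integrable_mult[OF a(2) b(2)] by simp
    finally show "(\<integral>x. (a k x - a' x) * (b k x - b' x) \<partial>mu V) + (\<integral>x. (a k x - a' x) * b' x \<partial>mu V)
      + (\<integral>x. (b k x - b' x) * a' x \<partial>mu V) + (\<integral>x. a' x * b' x \<partial>mu V) = (\<integral>x. a k x * b k x \<partial>mu V)" ..
  qed
  finally show ?thesis by simp
qed

section \<open>Integrals of compactly supported derivatives\<close>

lemma integrable_continuous_compact_support:
  fixes f :: "real \<Rightarrow> real"
  assumes "continuous_on UNIV f" "\<And>x. R < \<bar>x\<bar> \<Longrightarrow> f x = 0"
  shows "integrable lborel f"
proof -
  have "set_integrable lborel {-R..R} f"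
    by (rule borel_integrable_atLeastAtMost') (use assms continuous_on_subset in blast)
  moreover have "(\<lambda>x. indicat_real {-R..R} x *\<^sub>R f x) = f"
    using assms(2) by (intro ext) (metis abs_le_iff atLeastAtMost_iff indicator_simps(1) linorder_not_le
      minus_le_iff mult_zero_right real_scaleR_def scaleR_one)
  ultimately show ?thesis
    by (simp add: set_integrable_def)
qed

text \<open>Only \<open>F'\<close> has compact support; \<open>F\<close> may keep a nonzero value at
  infinity. The half-line factor is one of the two summands of the kernel \<open>sgn_between\<close>
  below.\<close>

lemma integral_tail_deriv:
  fixes F F' :: "real \<Rightarrow> real"
  assumes "\<And>x. (F has_real_derivative F' x) (at x)" "continuous_on UNIV F'"
    and "\<And>x. R < \<bar>x\<bar> \<Longrightarrow> F' x = 0" and "R < b" "t \<le> b"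
  shows "(\<integral>x. (if t \<le> x then 1 else 0) * F' x \<partial>lborel) = F b - F t"
proof -
  have "(\<integral>x. indicator {t..b} x *\<^sub>R F' x \<partial>lborel) = F b - F t"
    using assms by (intro integral_FTC_atLeastAtMost)
      (auto intro: continuous_on_subset has_field_derivative_at_within
        simp flip: has_real_derivative_iff_has_vector_derivative)
  moreover have "(\<lambda>x. indicator {t..b} x *\<^sub>R F' x) = (\<lambda>x. (if t \<le> x then 1 else 0) * F' x)"
    using assms(3,4) by (intro ext) (auto simp: indicator_def abs_if)
  ultimately show ?thesis by simp
qed

lemma integral_deriv_compact_support:
  fixes F F' :: "real \<Rightarrow> real"
  assumes "\<And>x. (F has_real_derivative F' x) (at x)" "continuous_on UNIV F'"
    and "\<And>x. R < \<bar>x\<bar> \<Longrightarrow> F' x = 0" and "a < - R" "R < b" "a \<le> b"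
  shows "(\<integral>x. F' x \<partial>lborel) = F b - F a"
proof -
  have "(\<lambda>x. (if a \<le> x then 1 else 0) * F' x) = F'"
    using assms(3,4) by (intro ext) (auto simp: abs_if)
  with integral_tail_deriv[OF assms(1-3,5,6)] show ?thesis by simp
qed

section \<open>The weighted space of a uniformly convex potential\<close>

lemma Lop_test_fun: "smooth V \<Longrightarrow> test_fun f \<Longrightarrow> test_fun (Lop V f)"
  unfolding Lop_def by (intro test_fun_diff test_fun_mult test_fun_deriv smooth_deriv)

lemma Lop_diff_cmult:
  assumes "smooth f" "smooth g"
  shows "Lop V (\<lambda>x. f x - c * g x) = (\<lambda>x. Lop V f x - c * Lop V g x)"
proof -
  have 1: "deriv (\<lambda>x. f x - c * g x) = (\<lambda>x. deriv f x - c * deriv g x)" if "smooth f" "smooth g" for f g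
  proof
    fix x
    show "deriv (\<lambda>x. f x - c * g x) x = deriv f x - c * deriv g x"
      using smooth_DERIV[OF that(1), of x] smooth_DERIV[OF that(2), of x]
      by (auto intro!: DERIV_imp_deriv derivative_eq_intros)
  qed
  show ?thesis
    unfolding Lop_def 1[OF assms] 1[OF assms[THEN smooth_deriv]] by (simp add: algebra_simps)
qed

lemma Lop_mult:
  assumes f: "smooth f" and g: "smooth g"
  shows "Lop V (\<lambda>x. g x * f x) x = g x * Lop V f x + 2 * (deriv g x * deriv f x) + f x * Lop V g x"
proof -
  have 1: "deriv (\<lambda>x. g x * f x) = (\<lambda>x. deriv g x * f x + g x * deriv f x)"
    using smooth_DERIV[OF f] smooth_DERIV[OF g]
    by (intro ext DERIV_imp_deriv) (auto intro!: derivative_eq_intros)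
  have 2: "deriv (\<lambda>x. deriv g x * f x + g x * deriv f x) x
      = deriv (deriv g) x * f x + 2 * (deriv g x * deriv f x) + g x * deriv (deriv f) x"
    using smooth_DERIV[OF f] smooth_DERIV[OF g] smooth_DERIV[OF smooth_deriv[OF f]] smooth_DERIV[OF smooth_deriv[OF g]]
    by (intro DERIV_imp_deriv) (auto intro!: derivative_eq_intros)
  show ?thesis
    unfolding Lop_def 1 2 by (simp add: algebra_simps)
qed

lemma Lop_const: "Lop V (\<lambda>_. c) = (\<lambda>_. 0)"
  by (simp add: Lop_def)

locale convex_potential =
  fixes V :: "real \<Rightarrow> real" and \<kappa> :: real
  assumes V: "smooth V" and \<kappa>: "\<kappa> > 0" and hess: "\<And>x. \<kappa> \<le> deriv (deriv V) x"
begin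

abbreviation "V' \<equiv> deriv V"
abbreviation "V'' \<equiv> deriv (deriv V)"
abbreviation "M \<equiv> mu V"
definition r :: "real \<Rightarrow> real" where "r x = exp (- V x) / normconst V"

lemmas V_DERIV = smooth_DERIV[OF V]
lemmas V'_DERIV = smooth_DERIV[OF smooth_deriv[OF V]]

lemma V_measurable [measurable]: "V \<in> borel_measurable borel" "V' \<in> borel_measurable borel"
    "V'' \<in> borel_measurable borel"
  by (intro smooth_measurable smooth_deriv V)+

section \<open>Strong convexity and Gaussian domination\<close>

lemma V'_increment: "x \<le> y \<Longrightarrow> V' x + \<kappa> * (y - x) \<le> V' y"
proof -
  assume "x \<le> y"
  have "V' x - \<kappa> * x \<le> V' y - \<kappa> * y"
  proof (rule DERIV_nonneg_imp_nondecreasing[OF \<open>x \<le> y\<close>])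
    fix z
    have "((\<lambda>x. V' x - \<kappa> * x) has_real_derivative V'' z - \<kappa>) (at z)"
      by (auto intro!: derivative_eq_intros V'_DERIV)
    with hess[of z] show "\<exists>D. ((\<lambda>x. V' x - \<kappa> * x) has_real_derivative D) (at z) \<and> 0 \<le> D"
      by (intro exI[of _ "V'' z - \<kappa>"]) auto
  qed
  then show ?thesis by (simp add: algebra_simps)
qed

text \<open>By \<open>V'_increment\<close>, the right side minus the left has a derivative in
  \<open>x\<close> with the sign of \<open>x - t\<close>, so it is smallest at \<open>x = t\<close>,
  where it vanishes.\<close>

lemma V_above_parabola: "V t + V' t * (x - t) + \<kappa> / 2 * (x - t)\<^sup>2 \<le> V x"
proof -
  define h where "h y = V y - V' t * (y - t) - \<kappa> / 2 * (y - t)\<^sup>2" for y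
  have h: "(h has_real_derivative V' y - V' t - \<kappa> * (y - t)) (at y)" for y
    unfolding h_def by (auto intro!: derivative_eq_intros V_DERIV)
  have "h t \<le> h x"
  proof (cases "t \<le> x")
    case True
    then show ?thesis
      by (rule DERIV_nonneg_imp_nondecreasing) (use h V'_increment[of t] in force)
  next
    case False
    then have "x \<le> t" by simp
    then show ?thesis
      by (rule DERIV_nonpos_imp_nonincreasing)
         (use h V'_increment[of _ t] in \<open>force simp: algebra_simps\<close>)
  qed
  then show ?thesis by (simp add: h_def)
qed

lemma V'_zero_exists: "\<exists>x. V' x = 0"
proof -
  \<comment> \<open>Over a distance \<bar>V' 0\<bar> / \<kappa> the derivative \<open>V'\<close>
    changes by at least \<bar>V' 0\<bar>.\<close>
  have "V' (- \<bar>V' 0\<bar> / \<kappa>) \<le> 0" "0 \<le> V' (\<bar>V' 0\<bar> / \<kappa>)"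
    using V'_increment[of "- \<bar>V' 0\<bar> / \<kappa>" 0] V'_increment[of 0 "\<bar>V' 0\<bar> / \<kappa>"] \<kappa> by auto
  moreover have "- \<bar>V' 0\<bar> / \<kappa> \<le> \<bar>V' 0\<bar> / \<kappa>"
    using \<kappa> by (simp add: field_simps)
  ultimately show ?thesis
    using IVT'[of V'] smooth_continuous[OF smooth_deriv[OF V]] by blast
qed

definition x0 :: real where "x0 = (SOME x. V' x = 0)"

lemma V'_x0: "V' x0 = 0"
  unfolding x0_def using someI_ex[OF V'_zero_exists] .

text \<open>The parabola at the minimum \<open>x0\<close> dominates \<open>exp (- V x)\<close> by a
  Gaussian of variance 1/\<kappa>. The moment of order 0 makes \<open>mu V\<close> finite; the
  second one is used to put \<open>V'\<close> into L2.\<close>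

lemma exp_V_moment_integrable: "integrable lborel (\<lambda>x. exp (- V x) * (x - x0) ^ n)"
proof (rule Bochner_Integration.integrable_bound)
  define \<sigma> where "\<sigma> = 1 / sqrt \<kappa>"
  have \<sigma>: "\<sigma> > 0" "\<sigma>\<^sup>2 = 1 / \<kappa>"
    using \<kappa> by (auto simp: \<sigma>_def power_divide)
  define C where "C = exp (- V x0) * sqrt (2 * pi * \<sigma>\<^sup>2)"
  show "integrable lborel (\<lambda>x. C * (normal_density x0 \<sigma> x * \<bar>x - x0\<bar> ^ n))"
    by (intro integrable_mult_right integrable_normal_moment_abs \<sigma>(1))
  have "exp (- V x) \<le> C * normal_density x0 \<sigma> x" for x
  proof -
    have "sqrt (2 * pi * \<sigma>\<^sup>2) \<noteq> 0"
      using \<sigma>(1) by simp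
    then have "C * normal_density x0 \<sigma> x = exp (- V x0) * exp (- (x - x0)\<^sup>2 / (2 * \<sigma>\<^sup>2))"
      unfolding C_def normal_density_def by (simp only: mult.assoc divide_inverse) simp
    also have "\<dots> = exp (- V x0 - \<kappa> / 2 * (x - x0)\<^sup>2)"
      unfolding \<sigma>(2) by (simp add: mult.commute flip: exp_add)
    finally have "C * normal_density x0 \<sigma> x = exp (- V x0 - \<kappa> / 2 * (x - x0)\<^sup>2)" .
    with V_above_parabola[of x0 x] show ?thesis
      by (simp add: V'_x0)
  qed
  then show "AE x in lborel. norm (exp (- V x) * (x - x0) ^ n)
      \<le> norm (C * (normal_density x0 \<sigma> x * \<bar>x - x0\<bar> ^ n))"
    unfolding real_norm_def abs_mult power_abs
    by (intro AE_I2) (simp add: mult_right_mono C_def flip: mult.assoc)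
qed measurable

lemma exp_V_integrable: "integrable lborel (\<lambda>x. exp (- V x))"
  using exp_V_moment_integrable[of 0] by simp

text \<open>A Bochner integral defaults to 0, so positivity rests on integrability: a zero integral
  would force \<open>exp (- V x) = 0\<close> almost everywhere.\<close>

lemma normconst_pos: "normconst V > 0"
proof -
  have "normconst V \<noteq> 0"
  proof
    assume "normconst V = 0"
    then have "AE x in lborel. exp (- V x) = 0"
      unfolding normconst_def
      by (subst (asm) integral_nonneg_eq_0_iff_AE) (auto simp: exp_V_integrable)
    then have "emeasure lborel (UNIV :: real set) = 0"
      by (subst (asm) AE_iff_measurable[OF _ refl]) auto
    then show False
      by simp
  qed
  moreover have "normconst V \<ge> 0"
    unfolding normconst_def by simp
  ultimately show ?thesis by simp
qed

lemma r_pos: "r x > 0"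
  using normconst_pos by (simp add: r_def)

lemma r_smooth: "smooth r"
  using smooth_mult[OF smooth_const[of "1 / normconst V"] smooth_exp[OF smooth_mult[OF smooth_const[of "-1"] V]]]
  by (simp add: r_def[abs_def])

lemma r_measurable [measurable]: "r \<in> borel_measurable borel"
  by (rule smooth_measurable[OF r_smooth])

lemma r_DERIV: "(r has_real_derivative - V' x * r x) (at x)"
  unfolding r_def using normconst_pos by (auto intro!: derivative_eq_intros V_DERIV)

lemma mu_eq: "M = density lborel (\<lambda>x. ennreal (r x))"
  by (simp add: mu_def r_def)

lemma integrable_mu: "f \<in> borel_measurable borel \<Longrightarrow> integrable M f \<longleftrightarrow> integrable lborel (\<lambda>x. r x * f x)"
  unfolding mu_eq using r_pos by (subst integrable_real_density) (auto intro!: AE_I2 less_imp_le)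

lemma integral_mu: "f \<in> borel_measurable borel \<Longrightarrow> (\<integral>x. f x \<partial>M) = (\<integral>x. r x * f x \<partial>lborel)"
  unfolding mu_eq using r_pos by (subst integral_real_density) (auto intro!: AE_I2 less_imp_le)

lemma mu_moment_integrable: "integrable M (\<lambda>x. (x - x0) ^ n)"
  using exp_V_moment_integrable[of n] by (subst integrable_mu) (auto simp: r_def)

lemma L2_bounded:
  assumes [measurable]: "f \<in> borel_measurable borel" and "\<And>x. \<bar>f x\<bar> \<le> B"
  shows "L2 V f"
  unfolding L2_def
proof
  show "integrable M (\<lambda>x. (f x)\<^sup>2)"
  proof (rule Bochner_Integration.integrable_bound)
    show "integrable M (\<lambda>x. B\<^sup>2 * (x - x0) ^ 0)"
      by (intro integrable_mult_right mu_moment_integrable)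
    have "(f x)\<^sup>2 \<le> B\<^sup>2" for x
      using power_mono[OF assms(2)[of x], of 2] by simp
    then show "AE x in M. norm ((f x)\<^sup>2) \<le> norm (B\<^sup>2 * (x - x0) ^ 0)"
      by simp
  qed simp
qed fact

lemma L2_const: "L2 V (\<lambda>_. c)"
  by (rule L2_bounded[where B = "\<bar>c\<bar>"]) auto

lemma L2_test_fun: "test_fun f \<Longrightarrow> L2 V f"
  using L2_bounded test_fun_bounded smooth_measurable test_fun_smooth by metis

section \<open>The adjoint derivative and the Bochner identity\<close>

definition dual :: "(real \<Rightarrow> real) \<Rightarrow> real \<Rightarrow> real" where
  "dual w = (\<lambda>x. V' x * w x - deriv w x)"

lemma test_fun_dual: "test_fun w \<Longrightarrow> test_fun (dual w)"
  unfolding dual_def by (intro test_fun_diff test_fun_mult test_fun_deriv smooth_deriv V)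

text \<open>As r' = -V' r, the derivative of r f w is r (f' w - f \<open>dual w\<close>). Compact
  support is asked of \<open>w\<close> alone, so that \<open>f\<close> may be a primitive of a test
  function.\<close>

lemma integral_by_parts:
  assumes f: "smooth f" and w: "test_fun w"
  shows "(\<integral>x. deriv f x * w x \<partial>M) = (\<integral>x. f x * dual w x \<partial>M)"
proof -
  have tf1: "test_fun (\<lambda>x. deriv f x * w x)" and tf2: "test_fun (\<lambda>x. f x * dual w x)"
    by (intro test_fun_mult smooth_deriv f w test_fun_dual)+
  have tr: "test_fun (\<lambda>x. r x * (deriv f x * w x))" "test_fun (\<lambda>x. r x * (f x * dual w x))"
    by (intro test_fun_mult r_smooth tf1 tf2)+
  define F' where "F' x = r x * (deriv f x * w x) - r x * (f x * dual w x)" for x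
  have F': "((\<lambda>x. r x * (f x * w x)) has_real_derivative F' x) (at x)" for x
    unfolding F'_def dual_def
    using r_DERIV[of x] smooth_DERIV[OF f, of x] smooth_DERIV[OF test_fun_smooth[OF w], of x]
    by (auto intro!: derivative_eq_intros simp: algebra_simps)
  have "test_fun F'"
    unfolding F'_def by (intro test_fun_diff tr)
  then obtain R where R: "R > 0" "\<And>x. R < \<bar>x\<bar> \<Longrightarrow> F' x = 0"
    using test_fun_supportE by metis
  obtain R' where R': "R' > 0" "\<And>x. R' < \<bar>x\<bar> \<Longrightarrow> w x = 0"
    using test_fun_supportE[OF w] by metis
  define b where "b = max R R' + 1"
  have "(\<integral>x. F' x \<partial>lborel) = r b * (f b * w b) - r (-b) * (f (-b) * w (-b))"
    by (rule integral_deriv_compact_support[OF F' _ R(2)])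
       (use \<open>test_fun F'\<close> R(1) in \<open>auto simp: b_def intro: smooth_continuous test_fun_smooth\<close>)
  also have "\<dots> = 0"
    using R' by (simp add: b_def)
  finally have "(\<integral>x. F' x \<partial>lborel) = 0" .
  moreover have "integrable lborel h" if "test_fun h" for h
    using that integrable_continuous_compact_support test_fun_supportE smooth_continuous test_fun_smooth
    by metis
  ultimately have "(\<integral>x. r x * (deriv f x * w x) \<partial>lborel) = (\<integral>x. r x * (f x * dual w x) \<partial>lborel)"
    unfolding F'_def using tr by simp
  then show ?thesis
    using tf1 tf2 by (simp add: integral_mu smooth_measurable test_fun_smooth)
qed

lemma Lop_eq_dual_deriv: "Lop V f = (\<lambda>x. - dual (deriv f) x)"
  by (simp add: Lop_def dual_def)

lemma energy_eq:
  assumes "test_fun \<phi>"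
  shows "- (\<integral>x. \<phi> x * Lop V \<phi> x \<partial>M) = (\<integral>x. (deriv \<phi> x)\<^sup>2 \<partial>M)"
  using integral_by_parts[OF test_fun_smooth[OF assms] test_fun_deriv[OF assms]]
  by (simp add: Lop_eq_dual_deriv power2_eq_square)

text \<open>The Bochner identity in dimension one: differentiating \<open>dual w\<close> gives
  \<open>V'' w - L w\<close>. The \<open>V''\<close> term is the source of the shift between
  consecutive eigenvalues.\<close>

lemma dual_norm_eq:
  assumes "test_fun w"
  shows "(\<integral>x. (dual w x)\<^sup>2 \<partial>M) = - (\<integral>x. w x * Lop V w x \<partial>M) + (\<integral>x. V'' x * (w x)\<^sup>2 \<partial>M)"
proof -
  note ws = test_fun_smooth[OF assms]
  have "deriv (dual w) = (\<lambda>x. V'' x * w x - Lop V w x)"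
  proof
    fix x
    show "deriv (dual w) x = V'' x * w x - Lop V w x"
      unfolding dual_def Lop_def
      using V'_DERIV[of x] smooth_DERIV[OF ws, of x] smooth_DERIV[OF smooth_deriv[OF ws], of x]
      by (auto intro!: DERIV_imp_deriv derivative_eq_intros)
  qed
  then have "(\<integral>x. (dual w x)\<^sup>2 \<partial>M) = (\<integral>x. (V'' x * w x - Lop V w x) * w x \<partial>M)"
    using integral_by_parts[OF test_fun_smooth[OF test_fun_dual[OF assms]] assms]
    by (simp add: power2_eq_square)
  also have "\<dots> = (\<integral>x. V'' x * w x * w x - w x * Lop V w x \<partial>M)"
    by (simp add: algebra_simps)
  also have "\<dots> = (\<integral>x. V'' x * w x * w x \<partial>M) - (\<integral>x. w x * Lop V w x \<partial>M)"
    by (intro Bochner_Integration.integral_diff L2_integrable_mult L2_test_fun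
        test_fun_mult smooth_deriv V assms Lop_test_fun)
  finally show ?thesis
    by (simp add: power2_eq_square mult.assoc)
qed

lemma V''_square_integrable: "test_fun w \<Longrightarrow> integrable M (\<lambda>x. V'' x * (w x)\<^sup>2)"
  using L2_integrable_mult[OF L2_test_fun[OF test_fun_mult[OF smooth_deriv[OF smooth_deriv[OF V]]]] L2_test_fun, of w w]
  by (simp add: power2_eq_square mult.assoc)

end

section \<open>Inverses of the derivative and of its adjoint\<close>

lemma nn_integral_translate:
  fixes f :: "real \<Rightarrow> ennreal"
  assumes [measurable]: "f \<in> borel_measurable borel"
  shows "(\<integral>\<^sup>+x. f (x - t) \<partial>lborel) = (\<integral>\<^sup>+x. f x \<partial>lborel)"
    and "(\<integral>\<^sup>+x. f (t - x) \<partial>lborel) = (\<integral>\<^sup>+x. f x \<partial>lborel)"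
  using nn_integral_real_affine[of f 1 "-t"] nn_integral_real_affine[of f "-1" t] by simp_all

text \<open>Young's inequality for L1 * L2. The root \<open>k\<close> of \<open>j\<close> splits the
  integrand as k (k \<gamma>), to which Cauchy-Schwarz applies before the order of integration is
  exchanged.\<close>

lemma nn_integral_convolution_square_le:
  fixes j \<gamma> :: "real \<Rightarrow> ennreal"
  assumes [measurable]: "j \<in> borel_measurable borel" "\<gamma> \<in> borel_measurable borel"
    and root: "\<And>y. j y = (k y)\<^sup>2" and [measurable]: "k \<in> borel_measurable borel"
  shows "(\<integral>\<^sup>+x. (\<integral>\<^sup>+t. j (x - t) * \<gamma> t \<partial>lborel)\<^sup>2 \<partial>lborel)
    \<le> (\<integral>\<^sup>+y. j y \<partial>lborel)\<^sup>2 * (\<integral>\<^sup>+t. (\<gamma> t)\<^sup>2 \<partial>lborel)"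
proof -
  define J where "J = (\<integral>\<^sup>+y. j y \<partial>lborel)"
  have "(\<integral>\<^sup>+t. j (x - t) * \<gamma> t \<partial>lborel)\<^sup>2 \<le> J * (\<integral>\<^sup>+t. j (x - t) * (\<gamma> t)\<^sup>2 \<partial>lborel)" for x
  proof -
    have "(\<integral>\<^sup>+t. k (x - t) * (k (x - t) * \<gamma> t) \<partial>lborel)\<^sup>2
      \<le> (\<integral>\<^sup>+t. (k (x - t))\<^sup>2 \<partial>lborel) * (\<integral>\<^sup>+t. (k (x - t) * \<gamma> t)\<^sup>2 \<partial>lborel)"
      by (rule Cauchy_Schwarz_nn_integral) measurable
    moreover have "(\<integral>\<^sup>+t. (k (x - t))\<^sup>2 \<partial>lborel) = J"
      unfolding J_def root[symmetric] by (rule nn_integral_translate) measurable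
    ultimately show ?thesis
      by (simp add: root power2_eq_square mult_ac)
  qed
  then have "(\<integral>\<^sup>+x. (\<integral>\<^sup>+t. j (x - t) * \<gamma> t \<partial>lborel)\<^sup>2 \<partial>lborel)
    \<le> (\<integral>\<^sup>+x. J * (\<integral>\<^sup>+t. j (x - t) * (\<gamma> t)\<^sup>2 \<partial>lborel) \<partial>lborel)"
    by (intro nn_integral_mono)
  also have "\<dots> = J * (\<integral>\<^sup>+x. (\<integral>\<^sup>+t. j (x - t) * (\<gamma> t)\<^sup>2 \<partial>lborel) \<partial>lborel)"
    by (rule nn_integral_cmult) measurable
  also have "(\<integral>\<^sup>+x. (\<integral>\<^sup>+t. j (x - t) * (\<gamma> t)\<^sup>2 \<partial>lborel) \<partial>lborel)
    = (\<integral>\<^sup>+t. (\<integral>\<^sup>+x. j (x - t) * (\<gamma> t)\<^sup>2 \<partial>lborel) \<partial>lborel)"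
    by (rule lborel_pair.Fubini'[symmetric]) measurable
  also have "\<dots> = (\<integral>\<^sup>+t. J * (\<gamma> t)\<^sup>2 \<partial>lborel)"
  proof (rule nn_integral_cong)
    fix t
    have "(\<integral>\<^sup>+x. j (x - t) * (\<gamma> t)\<^sup>2 \<partial>lborel) = (\<integral>\<^sup>+x. j (x - t) \<partial>lborel) * (\<gamma> t)\<^sup>2"
      by (rule nn_integral_multc) measurable
    then show "(\<integral>\<^sup>+x. j (x - t) * (\<gamma> t)\<^sup>2 \<partial>lborel) = J * (\<gamma> t)\<^sup>2"
      by (simp add: nn_integral_translate J_def)
  qed
  also have "\<dots> = J * (\<integral>\<^sup>+t. (\<gamma> t)\<^sup>2 \<partial>lborel)"
    by (rule nn_integral_cmult) measurable
  finally show ?thesis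
    by (simp add: J_def power2_eq_square mult.assoc)
qed

lemma ennreal_abs_integral_le:
  fixes f :: "'a \<Rightarrow> real"
  shows "ennreal \<bar>\<integral>x. f x \<partial>M\<bar> \<le> (\<integral>\<^sup>+x. ennreal \<bar>f x\<bar> \<partial>M)"
proof (cases "integrable M f")
  case True
  then show ?thesis
    using integral_norm_bound_ennreal[of M f] by simp
qed (simp add: not_integrable_integral_eq)

context convex_potential
begin

text \<open>The signed indicator of the interval between \<open>x0\<close> and \<open>x\<close>. As \<open>V\<close> grows away from its
  minimum \<open>x0\<close>, this kernel is dominated by a Gaussian convolution kernel after
  conjugation with the square root of the density.\<close>

definition sgn_between :: "real \<Rightarrow> real \<Rightarrow> real" where
  "sgn_between x t = (if t \<le> x then 1 else 0) - (if t \<le> x0 then 1 else 0)"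

text \<open>The exponent is half of the \<kappa>/2 in \<open>V_above_parabola\<close>, because the
  kernel is conjugated by \<open>q\<close>, the square root of the density.\<close>

definition gauss :: "real \<Rightarrow> real" where "gauss y = exp (- (\<kappa> / 4) * y\<^sup>2)"

definition q :: "real \<Rightarrow> real" where "q x = sqrt (r x)"

lemma q_pos: "q x > 0" and q_square: "(q x)\<^sup>2 = r x"
  using r_pos[of x] by (auto simp: q_def less_imp_le)

lemma q_measurable [measurable]: "q \<in> borel_measurable borel"
  unfolding q_def by measurable

lemma gauss_measurable [measurable]: "gauss \<in> borel_measurable borel"
  unfolding gauss_def by measurable

lemma sgn_between_measurable [measurable]:
  "(\<lambda>(x, t). sgn_between x t) \<in> borel_measurable (borel \<Otimes>\<^sub>M borel)"
  unfolding sgn_between_def by measurable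

lemma sgn_between_le: "\<bar>sgn_between x t\<bar> * q x \<le> gauss (x - t) * q t"
proof (cases "sgn_between x t = 0")
  case True
  then show ?thesis
    using q_pos[of t] by (simp add: gauss_def)
next
  case False
  then have s: "\<bar>sgn_between x t\<bar> = 1" and order: "x0 < t \<and> t \<le> x \<or> x < t \<and> t \<le> x0"
    by (auto simp: sgn_between_def split: if_splits)
  have "0 \<le> V' t * (x - t)"
  proof -
    have "V' t \<ge> 0" if "x0 < t"
    proof -
      have "\<kappa> * (t - x0) \<ge> 0" using \<kappa> that by simp
      then show ?thesis using V'_increment[of x0 t] V'_x0 that by simp
    qed
    moreover have "V' t \<le> 0" if "t \<le> x0"
    proof -
      have "\<kappa> * (x0 - t) \<ge> 0" using \<kappa> that by simp
      then show ?thesis using V'_increment[of t x0] V'_x0 that by simp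
    qed
    ultimately show ?thesis
      using order by (auto simp: zero_le_mult_iff)
  qed
  with V_above_parabola[of t x] have "V t + \<kappa> / 2 * (x - t)\<^sup>2 \<le> V x"
    by simp
  then have "exp (- V x) \<le> exp (- (\<kappa> / 2 * (x - t)\<^sup>2) - V t)"
    by simp
  also have "\<dots> = (gauss (x - t))\<^sup>2 * exp (- V t)"
    unfolding gauss_def exp_double[symmetric] exp_add[symmetric] by simp
  finally have "r x \<le> (gauss (x - t))\<^sup>2 * r t"
    using normconst_pos by (simp add: r_def field_simps)
  then have "q x \<le> sqrt ((gauss (x - t))\<^sup>2 * r t)"
    unfolding q_def by (rule real_sqrt_le_mono)
  then show ?thesis
    by (simp add: s q_def real_sqrt_mult gauss_def)
qed

abbreviation conv :: "(real \<Rightarrow> real) \<Rightarrow> real \<Rightarrow> ennreal" where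
  "conv g x \<equiv> (\<integral>\<^sup>+t. ennreal (gauss (x - t)) * ennreal (q t * \<bar>g t\<bar>) \<partial>lborel)"

text \<open>Multiplication by \<open>q\<close> carries L2(mu) isometrically to Lebesgue L2, where
  convolution estimates are available.\<close>

lemma L2_iff_nn: "L2 V g \<longleftrightarrow> g \<in> borel_measurable borel \<and> (\<integral>\<^sup>+x. (ennreal (q x * \<bar>g x\<bar>))\<^sup>2 \<partial>lborel) < \<infinity>"
proof -
  have "(ennreal (q x * \<bar>g x\<bar>))\<^sup>2 = ennreal (norm (r x * (g x)\<^sup>2))" for x
    using q_pos[of x] q_square[of x] r_pos[of x]
    by (simp add: ennreal_power power_mult_distrib abs_mult)
  then show ?thesis
    unfolding L2_def using integrable_mu[of "\<lambda>x. (g x)\<^sup>2"]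
    by (auto simp: integrable_iff_bounded)
qed

lemma conv_square_finite:
  assumes "L2 V g"
  shows "(\<integral>\<^sup>+x. (conv g x)\<^sup>2 \<partial>lborel) < \<infinity>"
proof -
  have [measurable]: "g \<in> borel_measurable borel"
    using assms by (simp add: L2_def)
  \<comment> \<open>Chosen so that 1/(2 \<sigma>^2) = \<kappa>/4, which makes \<open>gauss\<close> a
    multiple of a normal density.\<close>
  define \<sigma> where "\<sigma> = sqrt (2 / \<kappa>)"
  have \<sigma>: "\<sigma> > 0" "\<sigma>\<^sup>2 = 2 / \<kappa>"
    using \<kappa> by (auto simp: \<sigma>_def)
  have "gauss y = sqrt (2 * pi * \<sigma>\<^sup>2) * normal_density 0 \<sigma> y" for y
    unfolding gauss_def normal_density_def using \<sigma> \<kappa> by (simp add: field_simps)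
  then have "integrable lborel gauss"
    using \<sigma>(1) integrable_mult_right[OF integrable_normal_density] by (metis (no_types, lifting) Bochner_Integration.integrable_cong)
  then have "(\<integral>\<^sup>+y. ennreal (gauss y) \<partial>lborel) < \<infinity>"
    by (auto simp: integrable_iff_bounded gauss_def)
  moreover have "(\<integral>\<^sup>+t. (ennreal (q t * \<bar>g t\<bar>))\<^sup>2 \<partial>lborel) < \<infinity>"
    using assms L2_iff_nn by blast
  ultimately have "(\<integral>\<^sup>+y. ennreal (gauss y) \<partial>lborel)\<^sup>2 * (\<integral>\<^sup>+t. (ennreal (q t * \<bar>g t\<bar>))\<^sup>2 \<partial>lborel) < \<infinity>"
    by (simp add: ennreal_mult_less_top power2_eq_square)
  moreover have "(\<integral>\<^sup>+x. (conv g x)\<^sup>2 \<partial>lborel)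
    \<le> (\<integral>\<^sup>+y. ennreal (gauss y) \<partial>lborel)\<^sup>2 * (\<integral>\<^sup>+t. (ennreal (q t * \<bar>g t\<bar>))\<^sup>2 \<partial>lborel)"
  proof (rule nn_integral_convolution_square_le)
    show "ennreal (gauss y) = (ennreal (sqrt (gauss y)))\<^sup>2" for y
      by (simp add: ennreal_power gauss_def)
  qed measurable
  ultimately show ?thesis
    by (rule le_less_trans[rotated])
qed

lemma L2_conv_bound:
  assumes "L2 V g" and G: "G \<in> borel_measurable borel"
    and "\<And>x. ennreal (q x * \<bar>G x\<bar>) \<le> conv g x"
  shows "L2 V G"
proof -
  have "(\<integral>\<^sup>+x. (ennreal (q x * \<bar>G x\<bar>))\<^sup>2 \<partial>lborel) \<le> (\<integral>\<^sup>+x. (conv g x)\<^sup>2 \<partial>lborel)"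
    by (intro nn_integral_mono power_mono assms) simp
  also have "\<dots> < \<infinity>"
    by (rule conv_square_finite) fact
  finally show ?thesis
    using G by (simp add: L2_iff_nn)
qed

text \<open>The primitive vanishing at \<open>x0\<close>, written as a kernel integral over the
  whole line so that Fubini applies to it.\<close>

definition prim :: "(real \<Rightarrow> real) \<Rightarrow> real \<Rightarrow> real" where
  "prim g x = (\<integral>t. sgn_between x t * g t \<partial>lborel)"

text \<open>The adjoint of \<open>prim\<close> in L2(mu): the same kernel with the variables
  exchanged, and the density moved to the other side. On mean-zero test functions it inverts
  \<open>dual\<close>.\<close>

definition dual_prim :: "(real \<Rightarrow> real) \<Rightarrow> real \<Rightarrow> real" where
  "dual_prim h t = (\<integral>x. sgn_between x t * (h x * r x) \<partial>lborel) / r t"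

lemma nn_integral_kernel_le:
  assumes [measurable]: "g \<in> borel_measurable borel"
  shows "ennreal (q x) * (\<integral>\<^sup>+t. ennreal \<bar>sgn_between x t * g t\<bar> \<partial>lborel) \<le> conv g x"
proof -
  have "ennreal (q x) * (\<integral>\<^sup>+t. ennreal \<bar>sgn_between x t * g t\<bar> \<partial>lborel)
    = (\<integral>\<^sup>+t. ennreal (q x) * ennreal \<bar>sgn_between x t * g t\<bar> \<partial>lborel)"
    by (rule nn_integral_cmult[symmetric]) measurable
  also have "\<dots> \<le> conv g x"
  proof (rule nn_integral_mono)
    fix t
    have "q x * \<bar>sgn_between x t * g t\<bar> \<le> gauss (x - t) * (q t * \<bar>g t\<bar>)"
      using mult_right_mono[OF sgn_between_le[of x t], of "\<bar>g t\<bar>"] by (simp add: abs_mult mult_ac)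
    then show "ennreal (q x) * ennreal \<bar>sgn_between x t * g t\<bar> \<le> ennreal (gauss (x - t)) * ennreal (q t * \<bar>g t\<bar>)"
      using q_pos[of x] q_pos[of t] by (simp add: gauss_def ennreal_leI flip: ennreal_mult)
  qed
  finally show ?thesis .
qed

lemma L2_prim:
  assumes g: "L2 V g"
  shows "L2 V (prim g)"
proof (rule L2_conv_bound[OF g])
  have [measurable]: "g \<in> borel_measurable borel"
    using g by (simp add: L2_def)
  show "prim g \<in> borel_measurable borel"
    unfolding prim_def by measurable
  fix x
  have "ennreal (q x * \<bar>prim g x\<bar>) = ennreal (q x) * ennreal \<bar>prim g x\<bar>"
    using q_pos[of x] by (simp add: ennreal_mult)
  also have "\<dots> \<le> ennreal (q x) * (\<integral>\<^sup>+t. ennreal \<bar>sgn_between x t * g t\<bar> \<partial>lborel)"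
    unfolding prim_def by (intro mult_left_mono ennreal_abs_integral_le) simp
  also have "\<dots> \<le> conv g x"
    by (rule nn_integral_kernel_le) measurable
  finally show "ennreal (q x * \<bar>prim g x\<bar>) \<le> conv g x" .
qed

lemma L2_dual_prim:
  assumes h: "L2 V h"
  shows "L2 V (dual_prim h)"
proof (rule L2_conv_bound[OF h])
  have [measurable]: "h \<in> borel_measurable borel"
    using h by (simp add: L2_def)
  show "dual_prim h \<in> borel_measurable borel"
    unfolding dual_prim_def by measurable
  fix t
  have "q t * \<bar>dual_prim h t\<bar> = (1 / q t) * \<bar>\<integral>x. sgn_between x t * (h x * r x) \<partial>lborel\<bar>"
    using q_square[of t] q_pos[of t] r_pos[of t]
    by (simp add: dual_prim_def abs_divide power2_eq_square field_simps)
  then have "ennreal (q t * \<bar>dual_prim h t\<bar>)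
    = ennreal (1 / q t) * ennreal \<bar>\<integral>x. sgn_between x t * (h x * r x) \<partial>lborel\<bar>"
    using q_pos[of t] by (simp only: ennreal_mult[symmetric] abs_ge_zero zero_le_divide_1_iff less_imp_le)
  also have "\<dots> \<le> ennreal (1 / q t) * (\<integral>\<^sup>+x. ennreal \<bar>sgn_between x t * (h x * r x)\<bar> \<partial>lborel)"
    by (intro mult_left_mono ennreal_abs_integral_le) simp
  also have "\<dots> = (\<integral>\<^sup>+x. ennreal (1 / q t) * ennreal \<bar>sgn_between x t * (h x * r x)\<bar> \<partial>lborel)"
    by (rule nn_integral_cmult[symmetric]) measurable
  also have "\<dots> \<le> conv h t"
  proof (rule nn_integral_mono)
    fix x
    \<comment> \<open>Since \<open>gauss\<close> is even, the kernel bound for \<open>prim\<close>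
      also serves its adjoint.\<close>
    have "\<bar>sgn_between x t\<bar> * q x / q t \<le> gauss (t - x)"
      using sgn_between_le[of x t] q_pos[of t]
      by (simp add: field_simps gauss_def power2_commute[of t x])
    then have "\<bar>sgn_between x t\<bar> * q x / q t * (q x * \<bar>h x\<bar>) \<le> gauss (t - x) * (q x * \<bar>h x\<bar>)"
      using q_pos[of x] by (intro mult_right_mono) auto
    then have "1 / q t * \<bar>sgn_between x t * (h x * r x)\<bar> \<le> gauss (t - x) * (q x * \<bar>h x\<bar>)"
      using q_pos[of x] by (simp add: abs_mult mult_ac power2_eq_square flip: q_square)
    then show "ennreal (1 / q t) * ennreal \<bar>sgn_between x t * (h x * r x)\<bar>
        \<le> ennreal (gauss (t - x)) * ennreal (q x * \<bar>h x\<bar>)"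
      using q_pos[of x] q_pos[of t] by (simp add: gauss_def ennreal_leI flip: ennreal_mult)
  qed
  finally show "ennreal (q t * \<bar>dual_prim h t\<bar>) \<le> conv h t" .
qed

text \<open>This transports constraints: \<open>\<phi>\<close> is orthogonal to
  \<open>prim g\<close> exactly when \<open>dual_prim \<phi>\<close> is orthogonal to
  \<open>g\<close>. Fubini is justified by pairing \<open>q * \<bar>h\<bar>\<close> with
  \<open>conv g\<close> through Cauchy-Schwarz.\<close>

lemma prim_adjoint:
  assumes g: "L2 V g" and h: "L2 V h"
  shows "(\<integral>x. h x * prim g x \<partial>M) = (\<integral>t. dual_prim h t * g t \<partial>M)"
proof -
  have [measurable]: "g \<in> borel_measurable borel" "h \<in> borel_measurable borel"
    using g h by (simp_all add: L2_def)
  have [measurable]: "prim g \<in> borel_measurable borel" "dual_prim h \<in> borel_measurable borel"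
    using L2_prim[OF g] L2_dual_prim[OF h] by (simp_all add: L2_def)
  define f where "f x t = (h x * r x) * (sgn_between x t * g t)" for x t
  have f [measurable]: "case_prod f \<in> borel_measurable (lborel \<Otimes>\<^sub>M lborel)"
    unfolding f_def by measurable
  have "(\<integral>\<^sup>+z. ennreal (norm (case_prod f z)) \<partial>(lborel \<Otimes>\<^sub>M lborel))
    = (\<integral>\<^sup>+x. \<integral>\<^sup>+t. ennreal (norm (f x t)) \<partial>lborel \<partial>lborel)"
    by (subst lborel.nn_integral_fst[symmetric]) auto
  also have "\<dots> \<le> (\<integral>\<^sup>+x. ennreal (q x * \<bar>h x\<bar>) * conv g x \<partial>lborel)"
  proof (rule nn_integral_mono)
    fix x
    have "ennreal (norm (f x t)) = ennreal (q x * \<bar>h x\<bar>) * (ennreal (q x) * ennreal \<bar>sgn_between x t * g t\<bar>)" for t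
      using q_pos[of x]
      by (simp add: f_def abs_mult mult_ac power2_eq_square flip: q_square ennreal_mult)
    then have "(\<integral>\<^sup>+t. ennreal (norm (f x t)) \<partial>lborel)
      = ennreal (q x * \<bar>h x\<bar>) * (ennreal (q x) * (\<integral>\<^sup>+t. ennreal \<bar>sgn_between x t * g t\<bar> \<partial>lborel))"
      by (simp add: nn_integral_cmult)
    also have "\<dots> \<le> ennreal (q x * \<bar>h x\<bar>) * conv g x"
      by (intro mult_left_mono nn_integral_kernel_le) auto
    finally show "(\<integral>\<^sup>+t. ennreal (norm (f x t)) \<partial>lborel) \<le> ennreal (q x * \<bar>h x\<bar>) * conv g x" .
  qed
  also have "\<dots> < \<infinity>"
  proof -
    have "(\<integral>\<^sup>+x. ennreal (q x * \<bar>h x\<bar>) * conv g x \<partial>lborel)\<^sup>2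
      \<le> (\<integral>\<^sup>+x. (ennreal (q x * \<bar>h x\<bar>))\<^sup>2 \<partial>lborel) * (\<integral>\<^sup>+x. (conv g x)\<^sup>2 \<partial>lborel)"
      by (rule Cauchy_Schwarz_nn_integral) measurable
    also have "\<dots> < \<infinity>"
      using conv_square_finite[OF g] h L2_iff_nn[of h] by (simp add: ennreal_mult_less_top)
    finally show ?thesis
      by (simp add: power_less_top_ennreal)
  qed
  finally have "integrable (lborel \<Otimes>\<^sub>M lborel) (case_prod f)"
    using f by (simp add: integrable_iff_bounded)
  then have "(\<integral>t. (\<integral>x. f x t \<partial>lborel) \<partial>lborel) = (\<integral>x. (\<integral>t. f x t \<partial>lborel) \<partial>lborel)"
    by (rule lborel_pair.Fubini_integral)
  moreover have "(\<integral>t. f x t \<partial>lborel) = r x * (h x * prim g x)" for x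
    unfolding f_def prim_def integral_mult_right_zero by (simp only: mult_ac)
  moreover have "(\<integral>x. f x t \<partial>lborel) = r t * (dual_prim h t * g t)" for t
  proof -
    have "(\<integral>x. f x t \<partial>lborel) = (\<integral>x. sgn_between x t * (h x * r x) * g t \<partial>lborel)"
      by (simp add: f_def mult_ac)
    then show ?thesis
      using r_pos[of t] by (simp add: dual_prim_def mult_ac)
  qed
  ultimately show ?thesis
    by (simp add: integral_mu)
qed

end

lemma integral_FTC_greaterThanAtMost:
  fixes F f :: "real \<Rightarrow> real"
  assumes "a \<le> b" "\<And>x. (F has_real_derivative f x) (at x)" "continuous_on UNIV f"
  shows "(\<integral>x. indicator {a<..b} x * f x \<partial>lborel) = F b - F a"
proof -
  have [measurable]: "f \<in> borel_measurable borel"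
    using assms(3) by (rule borel_measurable_continuous_onI)
  have "(\<integral>x. indicator {a<..b} x * f x \<partial>lborel) = (\<integral>x. indicator {a..b} x *\<^sub>R f x \<partial>lborel)"
    by (rule integral_cong_AE)
       (use AE_lborel_singleton[of a] in \<open>auto elim!: eventually_mono simp: indicator_def\<close>)
  also have "\<dots> = F b - F a"
    using assms by (intro integral_FTC_atLeastAtMost)
      (auto intro: continuous_on_subset has_field_derivative_at_within
        simp flip: has_real_derivative_iff_has_vector_derivative)
  finally show ?thesis .
qed

context convex_potential
begin

section \<open>The kernel operators on smooth functions\<close>

lemma prim_eq:
  assumes "\<And>x. (F has_real_derivative w x) (at x)" "continuous_on UNIV w"
  shows "prim w x = F x - F x0"
proof (cases "x0 \<le> x")
  case True
  then have "(\<lambda>t. sgn_between x t * w t) = (\<lambda>t. indicator {x0<..x} t * w t)"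
    by (auto simp: sgn_between_def indicator_def)
  with integral_FTC_greaterThanAtMost[OF True assms] show ?thesis
    by (simp add: prim_def)
next
  case False
  then have "(\<lambda>t. sgn_between x t * w t) = (\<lambda>t. - (indicator {x<..x0} t * w t))"
    by (auto simp: sgn_between_def indicator_def)
  with integral_FTC_greaterThanAtMost[OF _ assms, of x x0] False show ?thesis
    by (simp add: prim_def)
qed

lemma prim_DERIV:
  assumes "smooth w"
  shows "(prim w has_real_derivative w x) (at x)"
proof -
  obtain F where F: "\<And>x. (F has_real_derivative w x) (at x)"
    using smooth_antideriv_exists[OF assms] by metis
  have "prim w = (\<lambda>x. F x - F x0)"
    using prim_eq[OF F smooth_continuous[OF assms]] by blast
  with F show ?thesis
    by (auto intro!: derivative_eq_intros)
qed

text \<open>The mean-zero condition is what makes \<open>dual_prim \<phi>\<close> vanish on both sides of the support of \<open>\<phi>\<close>.\<close>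

lemma dual_prim_test_fun:
  assumes \<phi>: "test_fun \<phi>" and mean: "(\<integral>x. \<phi> x \<partial>M) = 0"
  shows "test_fun (dual_prim \<phi>)" and "dual (dual_prim \<phi>) = \<phi>"
proof -
  have tf: "test_fun (\<lambda>x. \<phi> x * r x)"
    using test_fun_mult[OF r_smooth \<phi>] by (simp add: mult.commute)
  note cont = smooth_continuous[OF test_fun_smooth[OF tf], of UNIV]
  obtain F where F: "\<And>x. (F has_real_derivative \<phi> x * r x) (at x)" "smooth F"
    using smooth_antideriv_exists[OF test_fun_smooth[OF tf]] by metis
  obtain R where R: "R > 0" "\<And>x. R < \<bar>x\<bar> \<Longrightarrow> \<phi> x * r x = 0"
    using test_fun_supportE[OF tf] by metis
  have int0: "(\<integral>x. \<phi> x * r x \<partial>lborel) = 0"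
    using mean integral_mu[of \<phi>] smooth_measurable[OF test_fun_smooth[OF \<phi>]] by (simp add: mult.commute)
  define a where "a = F (- R - 1)"
  have F_right: "F b = a" if "R < b" for b
    using integral_deriv_compact_support[where R = R and a = "- R - 1" and b = b, OF F(1) cont R(2)] that R(1) int0
    by (simp add: a_def)
  have F_left: "F b = a" if "b < - R" for b
    using integral_deriv_compact_support[where R = R and a = b and b = "R + 1", OF F(1) cont R(2)] that R(1) int0 F_right[of "R + 1"]
    by simp
  \<comment> \<open>The \<open>x0\<close> part of the kernel multiplies the total integral, which is
    0, so only the right tail \<open>a - F t\<close> remains. The factor 1/r is smooth, which gives
    smoothness of the quotient.\<close>
  have dp: "dual_prim \<phi> t = (a - F t) * (normconst V * exp (V t))" for t
  proof -
    have i: "integrable lborel (\<lambda>x. \<phi> x * r x)"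
      using integrable_continuous_compact_support[OF cont R(2)] .
    have "integrable lborel (\<lambda>x. (if t \<le> x then 1 else 0) * (\<phi> x * r x))"
      by (rule Bochner_Integration.integrable_bound[OF i])
         (use smooth_measurable[OF test_fun_smooth[OF tf]] in auto)
    then have "(\<integral>x. sgn_between x t * (\<phi> x * r x) \<partial>lborel)
      = (\<integral>x. (if t \<le> x then 1 else 0) * (\<phi> x * r x) \<partial>lborel)
        - (\<integral>x. (if t \<le> x0 then 1 else 0) * (\<phi> x * r x) \<partial>lborel)"
      unfolding sgn_between_def left_diff_distrib
      by (intro Bochner_Integration.integral_diff) (use i in auto)
    also have "(\<integral>x. (if t \<le> x0 then 1 else 0) * (\<phi> x * r x) \<partial>lborel) = 0"
      using int0 by simp
    also have "(\<integral>x. (if t \<le> x then 1 else 0) * (\<phi> x * r x) \<partial>lborel) = F (max t (R + 1)) - F t"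
      by (rule integral_tail_deriv[OF F(1) cont R(2)]) auto
    also have "F (max t (R + 1)) = a"
      by (rule F_right) simp
    finally have "(\<integral>x. sgn_between x t * (\<phi> x * r x) \<partial>lborel) = a - F t"
      by simp
    moreover have "1 / r t = normconst V * exp (V t)"
      by (simp add: r_def exp_minus divide_inverse)
    ultimately show ?thesis
      unfolding dual_prim_def by (metis mult.right_neutral times_divide_eq_right)
  qed
  show "test_fun (dual_prim \<phi>)"
  proof (rule test_funI[where R = R])
    show "smooth (dual_prim \<phi>)"
      unfolding dp by (intro smooth_intros F V)
    show "dual_prim \<phi> x = 0" if "R < \<bar>x\<bar>" for x
      using that F_right[of x] F_left[of x] by (auto simp: dp abs_if split: if_splits)
  qed
  show "dual (dual_prim \<phi>) = \<phi>"
  proof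
    fix x
    have "(dual_prim \<phi> has_real_derivative
        - \<phi> x * (r x * (normconst V * exp (V x))) + V' x * dual_prim \<phi> x) (at x)"
      unfolding dp by (auto intro!: derivative_eq_intros F V_DERIV simp: algebra_simps)
    moreover have "r x * (normconst V * exp (V x)) = 1"
      using normconst_pos by (simp add: r_def exp_minus)
    ultimately have "(dual_prim \<phi> has_real_derivative - \<phi> x + V' x * dual_prim \<phi> x) (at x)"
      by simp
    then show "dual (dual_prim \<phi>) x = \<phi> x"
      by (simp add: dual_def DERIV_imp_deriv)
  qed
qed

section \<open>Rayleigh quotients on test functions\<close>

text \<open>The inner infimum of \<open>eigval\<close> is at least \<open>c\<close>, multiplied out
  so that functions of norm zero need no exclusion, and tested on test functions only.\<close>

definition rayleigh_bound :: "real \<Rightarrow> (nat \<Rightarrow> real \<Rightarrow> real) \<Rightarrow> nat \<Rightarrow> bool" where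
  "rayleigh_bound c g n \<longleftrightarrow> (\<forall>\<phi>. test_fun \<phi> \<longrightarrow> (\<forall>i<n. (\<integral>x. \<phi> x * g i x \<partial>M) = 0) \<longrightarrow>
     c * (\<integral>x. (\<phi> x)\<^sup>2 \<partial>M) \<le> - (\<integral>x. \<phi> x * Lop V \<phi> x \<partial>M))"

lemma L2_diff_cmult_tendsto_0:
  assumes a: "\<And>k. L2 V (a k)" "L2 V a'" "L2 V e"
    and lim: "(\<lambda>k. \<integral>x. (a k x - a' x)\<^sup>2 \<partial>M) \<longlonglongrightarrow> 0" and c: "c \<longlonglongrightarrow> 0"
  shows "(\<lambda>k. \<integral>x. (a k x - c k * e x - a' x)\<^sup>2 \<partial>M) \<longlonglongrightarrow> 0"
proof -
  have i: "integrable M (\<lambda>x. (a k x - a' x)\<^sup>2)" "integrable M (\<lambda>x. (e x)\<^sup>2)"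
      "integrable M (\<lambda>x. (a k x - c k * e x - a' x)\<^sup>2)" for k
    using L2_diff[OF a(1,2), of k] L2_diff[OF L2_diff[OF a(1) L2_cmult[OF a(3)]] a(2), of k "c k"] a(3)
    unfolding L2_def by auto
  have le: "(\<integral>x. (a k x - c k * e x - a' x)\<^sup>2 \<partial>M)
      \<le> 2 * (\<integral>x. (a k x - a' x)\<^sup>2 \<partial>M) + 2 * (c k)\<^sup>2 * (\<integral>x. (e x)\<^sup>2 \<partial>M)" for k
  proof -
    have "(u - v - u')\<^sup>2 \<le> 2 * (u - u')\<^sup>2 + 2 * v\<^sup>2" for u v u' :: real
      using zero_le_power2[of "u - u' + v"] by (simp add: power2_eq_square algebra_simps)
    from this[of "a k _" "c k * e _" "a' _"]
    have "(\<integral>x. (a k x - c k * e x - a' x)\<^sup>2 \<partial>M)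
        \<le> (\<integral>x. 2 * (a k x - a' x)\<^sup>2 + 2 * (c k)\<^sup>2 * (e x)\<^sup>2 \<partial>M)"
      using i by (intro integral_mono) (auto simp: power_mult_distrib mult.assoc)
    also have "\<dots> = 2 * (\<integral>x. (a k x - a' x)\<^sup>2 \<partial>M) + 2 * (c k)\<^sup>2 * (\<integral>x. (e x)\<^sup>2 \<partial>M)"
      using i by simp
    finally show ?thesis .
  qed
  have "(\<lambda>k. 2 * (\<integral>x. (a k x - a' x)\<^sup>2 \<partial>M) + 2 * (c k)\<^sup>2 * (\<integral>x. (e x)\<^sup>2 \<partial>M)) \<longlonglongrightarrow> 2 * 0 + 2 * 0\<^sup>2 * (\<integral>x. (e x)\<^sup>2 \<partial>M)"
    by (intro tendsto_intros lim c)
  then have lim0: "(\<lambda>k. 2 * (\<integral>x. (a k x - a' x)\<^sup>2 \<partial>M) + 2 * (c k)\<^sup>2 * (\<integral>x. (e x)\<^sup>2 \<partial>M)) \<longlonglongrightarrow> 0"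
    by simp
  show ?thesis
    by (rule tendsto_sandwich[OF _ _ tendsto_const lim0]) (use le in auto)
qed

text \<open>Approximants from the closure satisfy the constraints only in the limit. If some test
  function \<open>e\<close> meets the earlier constraints but not the last, a multiple of
  \<open>e\<close> repairs the last one; the multiple tends to 0 because \<open>f\<close> is
  orthogonal to \<open>g n\<close>. If there is no such \<open>e\<close>, the last constraint
  follows from the others on test functions.\<close>

lemma L_graph_orthogonal_approx:
  fixes g :: "nat \<Rightarrow> real \<Rightarrow> real"
  assumes fh: "(f, h) \<in> L_graph V"
    and "\<forall>i<n. L2 V (g i)" "\<forall>i<n. (\<integral>x. f x * g i x \<partial>M) = 0"
  shows "\<exists>\<phi>. (\<forall>k. test_fun (\<phi> k)) \<and> (\<forall>k. \<forall>i<n. (\<integral>x. \<phi> k x * g i x \<partial>M) = 0) \<and>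
      (\<lambda>k. \<integral>x. (\<phi> k x - f x)\<^sup>2 \<partial>M) \<longlonglongrightarrow> 0 \<and> (\<lambda>k. \<integral>x. (Lop V (\<phi> k) x - h x)\<^sup>2 \<partial>M) \<longlonglongrightarrow> 0"
  using assms(2,3)
proof (induction n)
  case 0
  then show ?case
    using fh unfolding L_graph_def by auto
next
  case (Suc n)
  have f: "L2 V f" and h: "L2 V h"
    using fh by (auto simp: L_graph_def)
  obtain \<phi> where \<phi>: "\<And>k. test_fun (\<phi> k)" "\<And>k i. i < n \<Longrightarrow> (\<integral>x. \<phi> k x * g i x \<partial>M) = 0"
    and lim: "(\<lambda>k. \<integral>x. (\<phi> k x - f x)\<^sup>2 \<partial>M) \<longlonglongrightarrow> 0" "(\<lambda>k. \<integral>x. (Lop V (\<phi> k) x - h x)\<^sup>2 \<partial>M) \<longlonglongrightarrow> 0"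
  proof -
    have "\<forall>i<n. L2 V (g i)" "\<forall>i<n. (\<integral>x. f x * g i x \<partial>M) = 0"
      using Suc.prems by auto
    from Suc.IH[OF this] show ?thesis
      using that by blast
  qed
  have gn: "L2 V (g n)"
    using Suc.prems by simp
  show ?case
  proof (cases "\<exists>e. test_fun e \<and> (\<forall>i<n. (\<integral>x. e x * g i x \<partial>M) = 0) \<and> (\<integral>x. e x * g n x \<partial>M) \<noteq> 0")
    case False
    with \<phi> have "(\<integral>x. \<phi> k x * g n x \<partial>M) = 0" for k
      by blast
    with \<phi>(2) have "(\<integral>x. \<phi> k x * g i x \<partial>M) = 0" if "i < Suc n" for k i
      using that by (cases "i = n") auto
    with \<phi>(1) lim show ?thesis by blast
  next
    case True
    then obtain e where e: "test_fun e" "\<And>i. i < n \<Longrightarrow> (\<integral>x. e x * g i x \<partial>M) = 0" "(\<integral>x. e x * g n x \<partial>M) \<noteq> 0"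
      by blast
    define c where "c k = (\<integral>x. \<phi> k x * g n x \<partial>M) / (\<integral>x. e x * g n x \<partial>M)" for k
    have "(\<lambda>k. \<integral>x. \<phi> k x * g n x \<partial>M) \<longlonglongrightarrow> (\<integral>x. f x * g n x \<partial>M)"
      by (rule L2_mult_tendsto[OF L2_test_fun[OF \<phi>(1)] f lim(1) gn gn]) simp
    then have "c \<longlonglongrightarrow> (\<integral>x. f x * g n x \<partial>M) / (\<integral>x. e x * g n x \<partial>M)"
      unfolding c_def using e(3) by (intro tendsto_intros)
    then have c: "c \<longlonglongrightarrow> 0"
      using Suc.prems(2) by simp
    define \<psi> where "\<psi> k x = \<phi> k x - c k * e x" for k x
    have "test_fun (\<psi> k)" for k
      unfolding \<psi>_def by (intro test_fun_diff test_fun_cmult \<phi> e)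
    moreover have "(\<integral>x. \<psi> k x * g i x \<partial>M) = 0" if "i < Suc n" for k i
    proof -
      have gi: "L2 V (g i)"
        using Suc.prems that by blast
      have "(\<integral>x. \<psi> k x * g i x \<partial>M) = (\<integral>x. \<phi> k x * g i x - c k * (e x * g i x) \<partial>M)"
        by (simp add: \<psi>_def algebra_simps)
      also have "\<dots> = (\<integral>x. \<phi> k x * g i x \<partial>M) - c k * (\<integral>x. e x * g i x \<partial>M)"
        using L2_integrable_mult[OF L2_test_fun[OF \<phi>(1)] gi, of k] L2_integrable_mult[OF L2_test_fun[OF e(1)] gi]
        by simp
      also have "\<dots> = 0"
        using \<phi>(2) e that by (cases "i = n") (auto simp: c_def)
      finally show ?thesis .
    qed
    moreover have "(\<lambda>k. \<integral>x. (\<psi> k x - f x)\<^sup>2 \<partial>M) \<longlonglongrightarrow> 0"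
      unfolding \<psi>_def by (intro L2_diff_cmult_tendsto_0 L2_test_fun \<phi> f e lim c)
    moreover have "(\<lambda>k. \<integral>x. (Lop V (\<psi> k) x - h x)\<^sup>2 \<partial>M) \<longlonglongrightarrow> 0"
      unfolding \<psi>_def Lop_diff_cmult[OF test_fun_smooth[OF \<phi>(1)] test_fun_smooth[OF e(1)]]
      by (intro L2_diff_cmult_tendsto_0 L2_test_fun Lop_test_fun V \<phi> h e lim c)
    ultimately show ?thesis by blast
  qed
qed

lemma rayleigh_bound_L_graph:
  assumes rb: "rayleigh_bound c g n" and g: "\<forall>i<n. L2 V (g i)"
    and fh: "(f, h) \<in> L_graph V" and orth: "\<forall>i<n. (\<integral>x. f x * g i x \<partial>M) = 0"
  shows "c * (\<integral>x. (f x)\<^sup>2 \<partial>M) \<le> - (\<integral>x. f x * h x \<partial>M)"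
proof -
  have f: "L2 V f" and h: "L2 V h"
    using fh by (auto simp: L_graph_def)
  obtain \<phi> where \<phi>: "\<And>k. test_fun (\<phi> k)" "\<And>k i. i < n \<Longrightarrow> (\<integral>x. \<phi> k x * g i x \<partial>M) = 0"
    and lim: "(\<lambda>k. \<integral>x. (\<phi> k x - f x)\<^sup>2 \<partial>M) \<longlonglongrightarrow> 0" "(\<lambda>k. \<integral>x. (Lop V (\<phi> k) x - h x)\<^sup>2 \<partial>M) \<longlonglongrightarrow> 0"
    using L_graph_orthogonal_approx[OF fh g orth] by blast
  note \<phi>2 = L2_test_fun[OF \<phi>(1)] and L\<phi>2 = L2_test_fun[OF Lop_test_fun[OF V \<phi>(1)]]
  have "(\<lambda>k. c * (\<integral>x. \<phi> k x * \<phi> k x \<partial>M)) \<longlonglongrightarrow> c * (\<integral>x. f x * f x \<partial>M)"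
    by (intro tendsto_mult tendsto_const L2_mult_tendsto \<phi>2 f lim)
  moreover have "(\<lambda>k. - (\<integral>x. \<phi> k x * Lop V (\<phi> k) x \<partial>M)) \<longlonglongrightarrow> - (\<integral>x. f x * h x \<partial>M)"
    by (intro tendsto_minus L2_mult_tendsto \<phi>2 L\<phi>2 f h lim)
  moreover have "c * (\<integral>x. \<phi> k x * \<phi> k x \<partial>M) \<le> - (\<integral>x. \<phi> k x * Lop V (\<phi> k) x \<partial>M)" for k
    using rb \<phi> by (simp add: rayleigh_bound_def power2_eq_square)
  ultimately show ?thesis
    by (simp add: power2_eq_square LIMSEQ_le)
qed

section \<open>Between the max-min formula and Rayleigh bounds\<close>

lemma eigval_ge:
  assumes "n > 0" and g: "\<forall>i<n. L2 V (g i)" and rb: "rayleigh_bound c g n"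
  shows "ereal c \<le> eigval V n"
proof -
  have "ereal c \<le> (INF fh \<in> {(f, h). (f, h) \<in> L_graph V \<and> (\<integral>x. (f x)^2 \<partial>M) \<noteq> 0 \<and>
                           (\<forall>i<n. (\<integral>x. f x * g i x \<partial>M) = 0)}.
          ereal ((- (\<integral>x. fst fh x * snd fh x \<partial>M)) / (\<integral>x. (fst fh x)^2 \<partial>M)))"
  proof (rule INF_greatest, clarify)
    fix f h
    assume fh: "(f, h) \<in> L_graph V" "(\<integral>x. (f x)\<^sup>2 \<partial>M) \<noteq> 0" "\<forall>i<n. (\<integral>x. f x * g i x \<partial>M) = 0"
    have "0 < (\<integral>x. (f x)\<^sup>2 \<partial>M)"
      using fh(2) by (simp add: less_le)
    then show "ereal c \<le> ereal (- (\<integral>x. fst (f, h) x * snd (f, h) x \<partial>M) / (\<integral>x. (fst (f, h) x)\<^sup>2 \<partial>M))"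
      using rayleigh_bound_L_graph[OF rb g fh(1,3)] by (simp add: pos_le_divide_eq del: minus_divide_left divide_minus_left)
  qed
  then show ?thesis
    unfolding eigval_def using assms by (auto intro!: SUP_upper2[of g])
qed

lemma test_fun_L_graph: "test_fun \<phi> \<Longrightarrow> (\<phi>, Lop V \<phi>) \<in> L_graph V"
  unfolding L_graph_def by (auto intro!: L2_test_fun Lop_test_fun V exI[of _ "\<lambda>_. \<phi>"])

lemma energy_nonneg: "test_fun \<phi> \<Longrightarrow> 0 \<le> - (\<integral>x. \<phi> x * Lop V \<phi> x \<partial>M)"
  by (simp add: energy_eq)

lemma rayleigh_bound_nonpos: "c \<le> 0 \<Longrightarrow> rayleigh_bound c g n"
  unfolding rayleigh_bound_def
  by (auto intro: order_trans[OF mult_nonpos_nonneg energy_nonneg])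

text \<open>The supremum is not known to be attained, so constraints are available only for numbers
  strictly below it. Index 0 has the value 0 by definition and is settled by nonnegativity of the
  energy.\<close>

lemma eigval_less_rayleigh_bound:
  assumes "ereal c < eigval V n"
  obtains g where "\<forall>i<n. L2 V (g i)" "rayleigh_bound c g n"
proof (cases "n = 0")
  case True
  with assms have "c \<le> 0"
    by (simp add: eigval_def)
  with True show thesis
    by (intro that[of undefined]) (auto simp: rayleigh_bound_nonpos)
next
  case False
  then obtain g where g: "\<forall>i<n. L2 V (g i)" and less:
    "ereal c < (INF fh \<in> {(f, h). (f, h) \<in> L_graph V \<and> (\<integral>x. (f x)^2 \<partial>M) \<noteq> 0 \<and>
                           (\<forall>i<n. (\<integral>x. f x * g i x \<partial>M) = 0)}.
          ereal ((- (\<integral>x. fst fh x * snd fh x \<partial>M)) / (\<integral>x. (fst fh x)^2 \<partial>M)))"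
    using assms unfolding eigval_def by (auto simp: less_SUP_iff)
  have "rayleigh_bound c g n"
    unfolding rayleigh_bound_def
  proof (intro allI impI)
    fix \<phi> assume \<phi>: "test_fun \<phi>" "\<forall>i<n. (\<integral>x. \<phi> x * g i x \<partial>M) = 0"
    show "c * (\<integral>x. (\<phi> x)\<^sup>2 \<partial>M) \<le> - (\<integral>x. \<phi> x * Lop V \<phi> x \<partial>M)"
    proof (cases "(\<integral>x. (\<phi> x)\<^sup>2 \<partial>M) = 0")
      case True
      then show ?thesis
        using energy_nonneg[OF \<phi>(1)] by simp
    next
      case False
      then have "0 < (\<integral>x. (\<phi> x)\<^sup>2 \<partial>M)"
        by (simp add: less_le)
      moreover have "ereal c < ereal ((- (\<integral>x. \<phi> x * Lop V \<phi> x \<partial>M)) / (\<integral>x. (\<phi> x)^2 \<partial>M))"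
        using less_INF_D[OF less, of "(\<phi>, Lop V \<phi>)"] test_fun_L_graph[OF \<phi>(1)] \<phi>(2) False by simp
      ultimately show ?thesis
        by (simp add: pos_less_divide_eq less_imp_le del: minus_divide_left divide_minus_left)
    qed
  qed
  with g that show thesis by blast
qed

lemma eigval_nonneg: "0 \<le> eigval V n"
proof (cases "n = 0")
  case False
  then show ?thesis
    using eigval_ge[of n "\<lambda>_ _. 0" 0] L2_const[of 0] rayleigh_bound_nonpos by (simp add: zero_ereal_def)
qed (simp add: eigval_def)

text \<open>The new constraint 1 makes \<open>\<phi>\<close> mean-zero, so
  \<open>\<phi> = dual w\<close> with a test function \<open>w\<close>; the constraints
  \<open>prim (g i)\<close> on \<open>\<phi>\<close> become \<open>g i\<close> on \<open>w\<close>.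
  The Bochner identity adds \<kappa> to the bound for \<open>w\<close>, and Cauchy-Schwarz returns
  it to \<open>\<phi>\<close>.\<close>

lemma rayleigh_bound_raise:
  assumes rb: "rayleigh_bound c g m" and g: "\<forall>i<m. L2 V (g i)"
  obtains G where "\<forall>i<Suc m. L2 V (G i)" "rayleigh_bound (c + \<kappa>) G (Suc m)"
proof -
  define G where "G i = (if i < m then prim (g i) else (\<lambda>_. 1))" for i
  have "\<forall>i<Suc m. L2 V (G i)"
    using g by (auto simp: G_def L2_prim L2_const)
  moreover have "rayleigh_bound (c + \<kappa>) G (Suc m)"
    unfolding rayleigh_bound_def
  proof (intro allI impI)
    fix \<phi> assume \<phi>: "test_fun \<phi>" and orth: "\<forall>i<Suc m. (\<integral>x. \<phi> x * G i x \<partial>M) = 0"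
    have "(\<integral>x. \<phi> x \<partial>M) = 0"
      using orth[rule_format, of m] by (simp add: G_def)
    note w = dual_prim_test_fun[OF \<phi> this]
    define w where "w = dual_prim \<phi>"
    have w: "test_fun w" "dual w = \<phi>"
      using w by (auto simp: w_def)
    have "(\<integral>x. w x * g i x \<partial>M) = 0" if "i < m" for i
      using orth[rule_format, of i] that prim_adjoint[of "g i" \<phi>] g L2_test_fun[OF \<phi>]
      by (simp add: G_def w_def)
    then have "c * (\<integral>x. (w x)\<^sup>2 \<partial>M) \<le> - (\<integral>x. w x * Lop V w x \<partial>M)"
      using rb w(1) by (simp add: rayleigh_bound_def)
    moreover have "\<kappa> * (\<integral>x. (w x)\<^sup>2 \<partial>M) \<le> (\<integral>x. V'' x * (w x)\<^sup>2 \<partial>M)"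
    proof -
      have "(\<integral>x. \<kappa> * (w x)\<^sup>2 \<partial>M) \<le> (\<integral>x. V'' x * (w x)\<^sup>2 \<partial>M)"
        using L2_test_fun[OF w(1)] hess
        by (intro integral_mono V''_square_integrable w mult_right_mono) (auto simp: L2_def)
      then show ?thesis by simp
    qed
    ultimately have energy: "(c + \<kappa>) * (\<integral>x. (w x)\<^sup>2 \<partial>M) \<le> (\<integral>x. (\<phi> x)\<^sup>2 \<partial>M)"
      using dual_norm_eq[OF w(1)] w(2) by (simp add: distrib_right)
    have "(\<integral>x. (\<phi> x)\<^sup>2 \<partial>M)\<^sup>2 \<le> (\<integral>x. (deriv \<phi> x)\<^sup>2 \<partial>M) * (\<integral>x. (w x)\<^sup>2 \<partial>M)"
    proof -
      have "(\<integral>x. (\<phi> x)\<^sup>2 \<partial>M) = (\<integral>x. deriv \<phi> x * w x \<partial>M)"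
        using integral_by_parts[OF test_fun_smooth[OF \<phi>] w(1)] w(2) by (simp add: power2_eq_square)
      then show ?thesis
        using L2_Cauchy_Schwarz[OF L2_test_fun[OF test_fun_deriv[OF \<phi>]] L2_test_fun[OF w(1)]] by simp
    qed
    from mult_le_of_Cauchy_Schwarz[OF this energy]
    show "(c + \<kappa>) * (\<integral>x. (\<phi> x)\<^sup>2 \<partial>M) \<le> - (\<integral>x. \<phi> x * Lop V \<phi> x \<partial>M)"
      unfolding energy_eq[OF \<phi>] by simp
  qed
  ultimately show thesis by (rule that)
qed


section \<open>Functions that are constant near infinity\<close>

text \<open>Bounded \<open>V''\<close> and \<open>V' x0 = 0\<close> give linear growth of
  \<open>V'\<close>, and second moments are finite.\<close>

lemma L2_V':
  assumes K: "\<And>x. V'' x \<le> K"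
  shows "L2 V V'"
  unfolding L2_def
proof
  show "integrable M (\<lambda>x. (V' x)\<^sup>2)"
  proof (rule Bochner_Integration.integrable_bound)
    show "integrable M (\<lambda>x. K\<^sup>2 * (x - x0)\<^sup>2)"
      by (intro integrable_mult_right mu_moment_integrable)
    have "(V' x)\<^sup>2 \<le> K\<^sup>2 * (x - x0)\<^sup>2" for x
    proof -
      obtain z where "V' x = (x - x0) * V'' z"
      proof (cases x x0 rule: linorder_cases)
        case less
        then show thesis
          using MVT2[OF less, of V' V''] V'_DERIV V'_x0 that by (metis minus_diff_eq mult_minus_left diff_0 minus_equation_iff)
      next
        case greater
        then show thesis
          using MVT2[OF greater, of V' V''] V'_DERIV V'_x0 that by (metis diff_zero)
      qed (use V'_x0 that in auto)
      moreover have "(V'' z)\<^sup>2 \<le> K\<^sup>2"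
        using K[of z] hess[of z] \<kappa> by (intro power_mono) auto
      ultimately show ?thesis
        by (simp add: power_mult_distrib mult.commute mult_right_mono)
    qed
    then show "AE x in M. norm ((V' x)\<^sup>2) \<le> norm (K\<^sup>2 * (x - x0)\<^sup>2)"
      by simp
  qed simp
qed measurable

text \<open>Cut \<open>f\<close> off far outside the support of its derivative. The error in L is
  then \<open>f\<close> times L of the cutoff: it tends to 0 pointwise and is dominated by a
  multiple of 1 + \<bar>V'\<bar>, which is square-integrable.\<close>

lemma test_fun_deriv_L_graph:
  assumes K: "\<And>x. V'' x \<le> K" and f: "smooth f" and f': "test_fun (deriv f)"
  shows "(f, Lop V f) \<in> L_graph V"
proof -
  obtain B where B: "\<And>x. \<bar>f x\<bar> \<le> B"
    using bounded_of_test_fun_deriv[OF f f'] by metis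
  have [measurable]: "f \<in> borel_measurable borel"
    by (rule smooth_measurable[OF f])
  have f2: "L2 V f"
    by (rule L2_bounded[OF _ B]) simp
  have Lf: "test_fun (Lop V f)"
    unfolding Lop_eq_dual_deriv using test_fun_cmult[OF test_fun_dual[OF f'], of "-1"] by simp
  have [measurable]: "Lop V f \<in> borel_measurable borel"
    by (rule smooth_measurable[OF test_fun_smooth[OF Lf]])
  obtain R where R: "\<And>x. R < \<bar>x\<bar> \<Longrightarrow> deriv f x = 0" "\<And>x. R < \<bar>x\<bar> \<Longrightarrow> Lop V f x = 0"
  proof -
    obtain R1 R2 where "\<And>x. R1 < \<bar>x\<bar> \<Longrightarrow> deriv f x = 0" "\<And>x. R2 < \<bar>x\<bar> \<Longrightarrow> Lop V f x = 0"
      using test_fun_supportE[OF f'] test_fun_supportE[OF Lf] by metis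
    then show thesis
      by (intro that[of "max R1 R2"]) simp_all
  qed
  obtain N where N: "R < real N"
    using reals_Archimedean2 by blast
  obtain cut :: "nat \<Rightarrow> real \<Rightarrow> real" and C where
    cut: "\<And>k. test_fun (cut k)" "\<And>k x. \<bar>x\<bar> \<le> real k \<Longrightarrow> cut k x = 1"
    and C: "\<And>k x. \<bar>cut k x\<bar> \<le> C" "\<And>k x. \<bar>deriv (cut k) x\<bar> \<le> C" "\<And>k x. \<bar>deriv (deriv (cut k)) x\<bar> \<le> C"
    using smooth_cutoffs_exist by metis
  have C0: "0 \<le> C" and B0: "0 \<le> B"
    using C(1)[of 0 0] B[of 0] by linarith+
  have cut': "deriv (cut k) x = 0" if "\<bar>x\<bar> < real k" for k x
    by (rule deriv_eq_0_on_open[OF open_abs_less]) (use that cut(2) in auto)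
  have cut'': "deriv (deriv (cut k)) x = 0" if "\<bar>x\<bar> < real k" for k x
    by (rule deriv_eq_0_on_open[OF open_abs_less]) (use that cut' in auto)
  \<comment> \<open>The shift by \<open>N\<close> puts the supports of \<open>deriv f\<close> and
    \<open>Lop V f\<close> where the cutoff is 1, so the cross term of \<open>Lop_mult\<close>
    vanishes.\<close>
  define \<phi> where "\<phi> k x = cut (k + N) x * f x" for k x
  have \<phi>: "test_fun (\<phi> k)" for k
    unfolding \<phi>_def mult.commute[of _ "f _"] by (intro test_fun_mult f cut)
  have [measurable]: "\<phi> k \<in> borel_measurable borel" "Lop V (\<phi> k) \<in> borel_measurable borel" for k
    using \<phi> Lop_test_fun[OF V \<phi>] by (auto intro: smooth_measurable test_fun_smooth)
  have L\<phi>: "Lop V (\<phi> k) x - Lop V f x = f x * Lop V (cut (k + N)) x" for k x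
  proof -
    have "deriv (cut (k + N)) x * deriv f x = 0" "(cut (k + N) x - 1) * Lop V f x = 0"
      using cut'[of x "k + N"] cut(2)[of x "k + N"] R[of x] N by (cases "R < \<bar>x\<bar>"; simp)+
    moreover have "Lop V (\<phi> k) x = cut (k + N) x * Lop V f x
        + 2 * (deriv (cut (k + N)) x * deriv f x) + f x * Lop V (cut (k + N)) x"
      unfolding \<phi>_def by (rule Lop_mult[OF f test_fun_smooth[OF cut(1)]])
    ultimately show ?thesis
      by auto
  qed
  have ev: "\<forall>\<^sub>F k in sequentially. \<bar>x\<bar> < real (k + N)" for x
    by (rule eventually_mono[OF eventually_gt_at_top[of "nat \<lceil>\<bar>x\<bar>\<rceil>"]]) linarith
  have "(\<lambda>k. \<integral>x. (\<phi> k x - f x)\<^sup>2 \<partial>M) \<longlonglongrightarrow> (\<integral>x. 0 \<partial>M)"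
  proof (rule integral_dominated_convergence[where w = "\<lambda>x. ((C + 1) * B)\<^sup>2"])
    show "integrable M (\<lambda>x. ((C + 1) * B)\<^sup>2)"
      using L2_const[of "(C + 1) * B"] by (simp add: L2_def)
    show "AE x in M. (\<lambda>k. (\<phi> k x - f x)\<^sup>2) \<longlonglongrightarrow> 0"
    proof (rule AE_I2)
      fix x
      have "\<forall>\<^sub>F k in sequentially. (\<phi> k x - f x)\<^sup>2 = 0"
        using ev[of x] by eventually_elim (simp add: \<phi>_def cut)
      then show "(\<lambda>k. (\<phi> k x - f x)\<^sup>2) \<longlonglongrightarrow> 0"
        by (rule tendsto_eventually)
    qed
    show "AE x in M. norm ((\<phi> k x - f x)\<^sup>2) \<le> ((C + 1) * B)\<^sup>2" for k
    proof (rule AE_I2)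
      fix x
      have "\<bar>cut (k + N) x - 1\<bar> * \<bar>f x\<bar> \<le> (C + 1) * B"
        using C(1)[of "k + N" x] B[of x] C0 by (intro mult_mono) auto
      moreover have "\<phi> k x - f x = (cut (k + N) x - 1) * f x"
        by (simp add: \<phi>_def algebra_simps)
      ultimately have "\<bar>\<phi> k x - f x\<bar> \<le> (C + 1) * B"
        by (simp add: abs_mult)
      then show "norm ((\<phi> k x - f x)\<^sup>2) \<le> ((C + 1) * B)\<^sup>2"
        using power_mono[of "\<bar>\<phi> k x - f x\<bar>" _ 2] by simp
    qed
  qed simp_all
  moreover have "(\<lambda>k. \<integral>x. (Lop V (\<phi> k) x - Lop V f x)\<^sup>2 \<partial>M) \<longlonglongrightarrow> (\<integral>x. 0 \<partial>M)"
  proof (rule integral_dominated_convergence[where w = "\<lambda>x. 2 * (B * C)\<^sup>2 + 2 * (B * C)\<^sup>2 * (V' x)\<^sup>2"])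
    show "integrable M (\<lambda>x. 2 * (B * C)\<^sup>2 + 2 * (B * C)\<^sup>2 * (V' x)\<^sup>2)"
      using L2_const[of "B * C"] L2_V'[OF K] by (simp add: L2_def)
    show "AE x in M. (\<lambda>k. (Lop V (\<phi> k) x - Lop V f x)\<^sup>2) \<longlonglongrightarrow> 0"
    proof (rule AE_I2)
      fix x
      have "\<forall>\<^sub>F k in sequentially. (Lop V (\<phi> k) x - Lop V f x)\<^sup>2 = 0"
        unfolding L\<phi> using ev[of x] by eventually_elim (simp add: Lop_def cut' cut'')
      then show "(\<lambda>k. (Lop V (\<phi> k) x - Lop V f x)\<^sup>2) \<longlonglongrightarrow> 0"
        by (rule tendsto_eventually)
    qed
    show "AE x in M. norm ((Lop V (\<phi> k) x - Lop V f x)\<^sup>2) \<le> 2 * (B * C)\<^sup>2 + 2 * (B * C)\<^sup>2 * (V' x)\<^sup>2" for k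
    proof (rule AE_I2)
      fix x
      have "\<bar>Lop V (cut (k + N)) x\<bar> \<le> \<bar>deriv (deriv (cut (k + N))) x\<bar> + \<bar>V' x\<bar> * \<bar>deriv (cut (k + N)) x\<bar>"
        unfolding Lop_def abs_mult[symmetric] by (rule abs_triangle_ineq4)
      also have "\<dots> \<le> C + \<bar>V' x\<bar> * C"
        by (intro add_mono mult_left_mono C) simp
      finally have "\<bar>f x\<bar> * \<bar>Lop V (cut (k + N)) x\<bar> \<le> B * (C + \<bar>V' x\<bar> * C)"
        using B B0 by (intro mult_mono) auto
      then have "\<bar>Lop V (\<phi> k) x - Lop V f x\<bar> \<le> B * C + B * C * \<bar>V' x\<bar>"
        by (simp add: L\<phi> abs_mult algebra_simps)
      then have "(Lop V (\<phi> k) x - Lop V f x)\<^sup>2 \<le> (B * C + B * C * \<bar>V' x\<bar>)\<^sup>2"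
        using power_mono[of "\<bar>Lop V (\<phi> k) x - Lop V f x\<bar>" _ 2] by simp
      also have "\<dots> \<le> 2 * (B * C)\<^sup>2 + 2 * (B * C * \<bar>V' x\<bar>)\<^sup>2"
        using zero_le_power2[of "B * C - B * C * \<bar>V' x\<bar>"] unfolding power2_sum power2_diff by linarith
      finally show "norm ((Lop V (\<phi> k) x - Lop V f x)\<^sup>2) \<le> 2 * (B * C)\<^sup>2 + 2 * (B * C)\<^sup>2 * (V' x)\<^sup>2"
        by (simp add: power_mult_distrib mult.assoc)
    qed
  qed simp_all
  ultimately show ?thesis
    unfolding L_graph_def using f2 L2_test_fun[OF Lf] \<phi> by auto
qed

text \<open>The constant 1 is annihilated by L and lies in the graph closure, so it tests the bound
  whenever no constraint excludes it.\<close>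

lemma rayleigh_bound_const:
  assumes K: "\<And>x. V'' x \<le> K" and "rayleigh_bound c g n" "\<forall>i<n. L2 V (g i)"
    and "\<And>i. i < n \<Longrightarrow> (\<integral>x. g i x \<partial>M) = 0"
  shows "c \<le> 0"
proof -
  have "test_fun (deriv (\<lambda>_. 1))"
    by (rule test_funI[where R = 0]) (auto simp: smooth_const)
  then have "(\<lambda>_. 1, Lop V (\<lambda>_. 1)) \<in> L_graph V"
    by (intro test_fun_deriv_L_graph[OF K] smooth_const)
  then have "c * (\<integral>x. 1 \<partial>M) \<le> 0"
    using rayleigh_bound_L_graph[OF assms(2,3)] assms(4) by (force simp: Lop_const)
  moreover have "(\<integral>x. (1::real) \<partial>M) = 1"
    using normconst_pos by (subst integral_mu) (auto simp: r_def normconst_def)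
  ultimately show ?thesis by simp
qed

text \<open>If all constraints have mean zero, then \<open>c\<close> is at most 0 and the claim is
  trivial. Otherwise some \<open>g j\<close> fixes the additive constant of a primitive
  \<open>f\<close> of \<open>w\<close>, and the other constraints, corrected by multiples of
  \<open>g j\<close> to mean zero, no longer see that constant and pass to \<open>w\<close>.\<close>

lemma rayleigh_bound_reduce:
  assumes K: "\<And>x. V'' x \<le> K" and rb: "rayleigh_bound c g (Suc m)" and g: "\<forall>i<Suc m. L2 V (g i)"
  obtains G where "\<forall>i<m. L2 V (G i)" "rayleigh_bound (c - K) G m"
proof (cases "\<exists>j<Suc m. (\<integral>x. g j x \<partial>M) \<noteq> 0")
  case False
  then have "c \<le> 0"
    using rayleigh_bound_const[OF K rb g] by blast
  moreover have "K > 0"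
    using K[of 0] hess[of 0] \<kappa> by linarith
  ultimately have "rayleigh_bound (c - K) (\<lambda>_ _. 0) m"
    by (intro rayleigh_bound_nonpos) simp
  then show thesis
    by (intro that[of "\<lambda>_ _. 0"]) (auto simp: L2_const)
next
  case True
  then obtain j where j: "j < Suc m" "(\<integral>x. g j x \<partial>M) \<noteq> 0"
    by blast
  \<comment> \<open>Enumerates the indices below \<open>Suc m\<close> other than
    \<open>j\<close>.\<close>
  define skip where "skip i = (if i < j then i else Suc i)" for i
  have skip: "skip i < Suc m" if "i < m" for i
    using that j by (auto simp: skip_def)
  have skip_surj: "\<exists>i'<m. i = skip i'" if "i < Suc m" "i \<noteq> j" for i
    using that j(1) by (intro exI[of _ "if i < j then i else i - 1"]) (auto simp: skip_def)
  define b where "b i = (\<integral>x. g (skip i) x \<partial>M) / (\<integral>x. g j x \<partial>M)" for i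
  define g' where "g' i x = g (skip i) x - b i * g j x" for i x
  have gj: "L2 V (g j)"
    using g j by blast
  have gs: "L2 V (g (skip i))" if "i < m" for i
    using g skip[OF that] by blast
  have g': "L2 V (g' i)" if "i < m" for i
    unfolding g'_def by (intro L2_diff L2_cmult gj gs that)
  have L1: "integrable M h" if "L2 V h" for h
    using L2_integrable_mult[OF that L2_const[of 1]] by simp
  have mean: "(\<integral>x. g' i x \<partial>M) = 0" if "i < m" for i
    using L1[OF gj] L1[OF gs[OF that]] j(2) by (simp add: g'_def b_def)
  define G where "G i = dual_prim (g' i)" for i
  have "rayleigh_bound (c - K) G m"
    unfolding rayleigh_bound_def
  proof (intro allI impI)
    fix w assume w: "test_fun w" and orth: "\<forall>i<m. (\<integral>x. w x * G i x \<partial>M) = 0"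
    have w2: "L2 V w"
      by (rule L2_test_fun[OF w])
    have prim2: "L2 V (prim w)"
      by (rule L2_prim[OF w2])
    \<comment> \<open>The choice of constant that makes \<open>f\<close> orthogonal to
      \<open>g j\<close>.\<close>
    define a where "a = - (\<integral>x. prim w x * g j x \<partial>M) / (\<integral>x. g j x \<partial>M)"
    define f where "f x = prim w x + a" for x
    have fD: "(f has_real_derivative w x) (at x)" for x
      unfolding f_def using prim_DERIV[OF test_fun_smooth[OF w], of x]
      by (auto intro!: derivative_eq_intros)
    have f': "deriv f = w"
      using fD DERIV_imp_deriv by blast
    have fs: "smooth f"
      by (rule smooth_antideriv[OF fD test_fun_smooth[OF w]])
    have f2: "L2 V f"
      unfolding f_def by (intro L2_add prim2 L2_const)
    have f_mult: "(\<integral>x. f x * h x \<partial>M) = (\<integral>x. prim w x * h x \<partial>M) + a * (\<integral>x. h x \<partial>M)" if "L2 V h" for h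
      using L2_integrable_mult[OF prim2 that] L1[OF that] by (simp add: f_def distrib_right)
    have orth_j: "(\<integral>x. f x * g j x \<partial>M) = 0"
      using j(2) by (simp add: f_mult[OF gj] a_def)
    have orth_skip: "(\<integral>x. f x * g (skip i) x \<partial>M) = 0" if "i < m" for i
    proof -
      have "(\<integral>x. f x * g (skip i) x \<partial>M) = (\<integral>x. f x * g' i x + b i * (f x * g j x) \<partial>M)"
        by (simp add: g'_def algebra_simps)
      also have "\<dots> = (\<integral>x. f x * g' i x \<partial>M)"
        using L2_integrable_mult[OF f2 gj] L2_integrable_mult[OF f2 g'[OF that]] orth_j by simp
      also have "\<dots> = (\<integral>x. g' i x * prim w x \<partial>M)"
        by (simp add: f_mult[OF g'[OF that]] mean[OF that] mult.commute)
      also have "\<dots> = 0"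
        using prim_adjoint[OF w2 g'[OF that]] orth that by (simp add: G_def mult.commute)
      finally show ?thesis .
    qed
    have "\<forall>i<Suc m. (\<integral>x. f x * g i x \<partial>M) = 0"
      using orth_j orth_skip skip_surj by metis
    then have "c * (\<integral>x. (f x)\<^sup>2 \<partial>M) \<le> - (\<integral>x. f x * Lop V f x \<partial>M)"
      by (intro rayleigh_bound_L_graph[OF rb g] test_fun_deriv_L_graph[OF K] fs) (simp_all add: f' w)
    moreover have by_parts: "(\<integral>x. (w x)\<^sup>2 \<partial>M) = (\<integral>x. dual w x * f x \<partial>M)"
      using integral_by_parts[OF fs w] by (simp add: f' power2_eq_square mult.commute)
    ultimately have cf: "c * (\<integral>x. (f x)\<^sup>2 \<partial>M) \<le> (\<integral>x. (w x)\<^sup>2 \<partial>M)"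
      by (simp add: Lop_eq_dual_deriv f' mult.commute)
    have "(\<integral>x. (w x)\<^sup>2 \<partial>M)\<^sup>2 \<le> (\<integral>x. (dual w x)\<^sup>2 \<partial>M) * (\<integral>x. (f x)\<^sup>2 \<partial>M)"
      unfolding by_parts by (intro L2_Cauchy_Schwarz f2 L2_test_fun test_fun_dual w)
    \<comment> \<open>Now the bound goes from the derivative to its adjoint, the reverse of
      \<open>rayleigh_bound_raise\<close>.\<close>
    from mult_le_of_Cauchy_Schwarz[OF this cf]
    have "c * (\<integral>x. (w x)\<^sup>2 \<partial>M) \<le> (\<integral>x. (dual w x)\<^sup>2 \<partial>M)"
      by simp
    moreover have "(\<integral>x. V'' x * (w x)\<^sup>2 \<partial>M) \<le> (\<integral>x. K * (w x)\<^sup>2 \<partial>M)"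
      using w2 K by (intro integral_mono V''_square_integrable w mult_right_mono) (auto simp: L2_def)
    ultimately show "(c - K) * (\<integral>x. (w x)\<^sup>2 \<partial>M) \<le> - (\<integral>x. w x * Lop V w x \<partial>M)"
      using dual_norm_eq[OF w] by (simp add: left_diff_distrib)
  qed
  moreover have "\<forall>i<m. L2 V (G i)"
    unfolding G_def using L2_dual_prim g' by blast
  ultimately show thesis
    using that by blast
qed

section \<open>Consecutive eigenvalues\<close>

lemma eigval_Suc_ge: "eigval V m + ereal \<kappa> \<le> eigval V (Suc m)"
proof -
  have step: "ereal (c + \<kappa>) \<le> eigval V (Suc m)" if "ereal c < eigval V m" for c
    using eigval_less_rayleigh_bound[OF that] rayleigh_bound_raise eigval_ge
    by (metis zero_less_Suc)
  show ?thesis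
  proof (cases "eigval V m")
    case (real a)
    show ?thesis
    proof (rule ereal_le_epsilon2)
      fix e :: real assume "0 < e"
      then have "ereal (a - e + \<kappa>) \<le> eigval V (Suc m)"
        by (intro step) (simp add: real)
      then show "eigval V m + ereal \<kappa> \<le> eigval V (Suc m) + ereal e"
        using real by (cases "eigval V (Suc m)") auto
    qed
  next
    case PInf
    have "eigval V (Suc m) = \<infinity>"
    proof (rule ereal_top)
      fix B
      show "ereal B \<le> eigval V (Suc m)"
        using step[of "B - \<kappa>"] PInf by simp
    qed
    then show ?thesis by simp
  qed (use eigval_nonneg[of m] in auto)
qed

lemma eigval_Suc_le:
  assumes K: "\<And>x. V'' x \<le> K"
  shows "eigval V (Suc m) \<le> eigval V m + ereal K"
proof (rule dense_le)
  fix y assume "y < eigval V (Suc m)"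
  show "y \<le> eigval V m + ereal K"
  proof (cases y)
    case (real c)
    obtain g where "\<forall>i<Suc m. L2 V (g i)" "rayleigh_bound c g (Suc m)"
      using eigval_less_rayleigh_bound \<open>y < eigval V (Suc m)\<close> real by metis
    then obtain G where G: "\<forall>i<m. L2 V (G i)" "rayleigh_bound (c - K) G m"
      using rayleigh_bound_reduce[OF K] by metis
    have "ereal (c - K) \<le> eigval V m"
    \<comment> \<open>\<open>eigval V 0\<close> is 0 by convention and not a max-min value; here the
      constant function, free of constraints, gives \<open>c - K \<le> 0\<close>.\<close>
    proof (cases "m = 0")
      case True
      then have "c - K \<le> 0"
        using rayleigh_bound_const[OF K G(2)] by simp
      with True show ?thesis
        by (simp add: eigval_def zero_ereal_def)
    qed (use eigval_ge G in auto)
    then show ?thesis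
      using real by (cases "eigval V m") auto
  next
    case MInf
    then show ?thesis by simp
  qed (use \<open>y < eigval V (Suc m)\<close> in auto)
qed

end

theorem mainTheorem8:
  fixes V :: "real \<Rightarrow> real" and n :: nat
  assumes "smooth V"
    and "(INF x. ereal (deriv (deriv V) x)) > 0"
    and "n \<ge> 1"
  shows "(INF x. ereal (deriv (deriv V) x)) \<le> eigval V n - eigval V (n - 1)
       \<and> eigval V n - eigval V (n - 1) \<le> (SUP x. ereal (deriv (deriv V) x))"
proof -
  obtain m where n: "n = Suc m"
    using assms(3) by (cases n) auto
  have inf_le: "(INF x. ereal (deriv (deriv V) x)) \<le> ereal (deriv (deriv V) x)" for x
    by (rule INF_lower) simp
  obtain \<kappa> where inf_eq: "(INF x. ereal (deriv (deriv V) x)) = ereal \<kappa>"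
    using assms(2) inf_le[of 0] by (cases "INF x. ereal (deriv (deriv V) x)") auto
  interpret convex_potential V \<kappa>
    using assms(1,2) inf_le inf_eq by unfold_locales auto
  \<comment> \<open>In \<open>ereal\<close>, \<infinity> - \<infinity> is \<infinity>, so the lower
    bound survives infinite eigenvalues.\<close>
  have "ereal \<kappa> \<le> eigval V (Suc m) - eigval V m"
    using eigval_Suc_ge[of m] eigval_nonneg[of m]
    by (cases "eigval V m"; cases "eigval V (Suc m)") auto
  moreover have "eigval V (Suc m) - eigval V m \<le> (SUP x. ereal (deriv (deriv V) x))"
  proof (cases "SUP x. ereal (deriv (deriv V) x)")
    case (real K)
    have K: "deriv (deriv V) x \<le> K" for x
      using SUP_upper[of x UNIV "\<lambda>x. ereal (deriv (deriv V) x)"] real by simp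
    \<comment> \<open>The convention \<infinity> - \<infinity> = \<infinity> would break the upper
      bound; iterating the upper step from index 0 excludes it.\<close>
    have finite: "eigval V m < \<infinity>" for m
    proof (induction m)
      case 0
      then show ?case by (simp add: eigval_def)
    next
      case (Suc m)
      have "eigval V (Suc m) \<le> eigval V m + ereal K"
        by (rule eigval_Suc_le) (rule K)
      also have "\<dots> < \<infinity>"
        using Suc by simp
      finally show ?case .
    qed
    have "eigval V (Suc m) \<le> eigval V m + ereal K"
      by (rule eigval_Suc_le) (rule K)
    then show ?thesis
      unfolding real using finite[of m] eigval_nonneg[of m]
      by (cases "eigval V m"; cases "eigval V (Suc m)") auto
  next
    case MInf
    then show ?thesis
      using SUP_upper[of 0 UNIV "\<lambda>x. ereal (deriv (deriv V) x)"] by simp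
  qed simp
  ultimately show ?thesis
    unfolding n inf_eq diff_Suc_1 by blast
qed

end
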